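(* Let $D\subsetneq\mathbb{R}^n$ be a length $a$-John domain with center $x_0$, and let $\eta:[0,\infty)\to[0,\infty)$ be a homeomorphism. If $f:D\to D'\subset\mathbb{R}^n$ is an $\eta$-quasisymmetric homeomorphism (onto $D'$), then $D'$ is a length $a'$-John domain with center $x_0'=f(x_0)$, where $a'$ depends only on $a$ and $\eta$.
   Context: A domain is a nonempty open connected subset of $\mathbb{R}^n$, equipped with the Euclidean metric; $\partial D$ is its boundary and $d(z)=\operatorname{dist}(z,\partial D)$ for $z\in D$ (similarly for $D'$). $\ell$ denotes the length of a curve. For an arc $\alpha$ starting at $x$ and $z\in\alpha$, $\alpha[x,z]$ is the part of $\alpha$ between $x$ and $z$. For $a\ge1$, $D$ is a length $a$-John domain with center $x_0\in D$ if every $x\in D$ can be joined to $x_0$ by an arc $\alpha$ in $D$ with $\ell(\alpha[x,z])\le a\,d(z)$ for all $z\in\alpha$. A homeomorphism $f$ from a metric space $X$ to a metric space $Y$ is $\eta$-quasisymmetric, where $\eta:[0,\infty)\to[0,\infty)$ is a homeomorphism, if $|x-a|\le t|x-b|$ implies $|f(x)-f(a)|\le \eta(t)|f(x)-f(b)|$ for each $t\ge0$ and each triple $x,a,b$ of points of $X$. *)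

theory Defs
  imports "HOL-Analysis.Analysis"
begin

text \<open>
  John constants are to be bounded independently of the dimension, so the dimension is an ordinary
  natural number and not the cardinality of an index type: the space of dimension \<open>n\<close> has the carrier of
  \<^const>\<open>Euclidean_space\<close>, that is, the real sequences vanishing from index \<open>n\<close> on.
\<close>

definition euclid :: "nat \<Rightarrow> (nat \<Rightarrow> real) metric" where
  "euclid n = metric ({x. \<forall>i\<ge>n. x i = 0}, \<lambda>x y. sqrt (\<Sum>i<n. (x i - y i)\<^sup>2))"

definition domain_in :: "nat \<Rightarrow> (nat \<Rightarrow> real) set \<Rightarrow> bool" where
  "domain_in n D \<longleftrightarrow>
     D \<noteq> {} \<and> openin (mtopology_of (euclid n)) D \<and> connectedin (mtopology_of (euclid n)) D"

text \<open>
  Taking values in \<^typ>\<open>ennreal\<close> gives distance \<open>\<infinity>\<close> to an empty boundary.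
\<close>
definition boundary_dist :: "nat \<Rightarrow> (nat \<Rightarrow> real) set \<Rightarrow> (nat \<Rightarrow> real) \<Rightarrow> ennreal" where
  "boundary_dist n D z =
     (INF w \<in> mtopology_of (euclid n) frontier_of D. ennreal (mdist (euclid n) z w))"

text \<open>
  Length of the restriction of \<open>g\<close> to \<open>{s..t}\<close>; it is \<open>\<infinity>\<close> for non-rectifiable curves.
\<close>
definition curve_length :: "'a metric \<Rightarrow> (real \<Rightarrow> 'a) \<Rightarrow> real \<Rightarrow> real \<Rightarrow> ennreal" where
  "curve_length m g s t =
     (SUP p \<in> {p. sorted p \<and> set p \<subseteq> {s..t}}.
        ennreal (\<Sum>i<length p - 1. mdist m (g (p ! i)) (g (p ! Suc i))))"

text \<open>
  An arc is given by an injective parametrization on \<open>{0..1}\<close>, and its part between \<open>x = g 0\<close> and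
  \<open>z = g t\<close> is the restriction to \<open>{0..t}\<close>. The point \<open>x = x\<^sub>0\<close> is joined to itself by the
  degenerate arc \<open>{x\<^sub>0}\<close> of length \<open>0\<close>, which has no injective parametrization and satisfies
  the inequality trivially.
\<close>
definition length_John_domain ::
    "nat \<Rightarrow> real \<Rightarrow> (nat \<Rightarrow> real) set \<Rightarrow> (nat \<Rightarrow> real) \<Rightarrow> bool" where
  "length_John_domain n a D x\<^sub>0 \<longleftrightarrow>
     domain_in n D \<and> x\<^sub>0 \<in> D \<and>
     (\<forall>x \<in> D - {x\<^sub>0}. \<exists>g.
        pathin (subtopology (mtopology_of (euclid n)) D) g \<and> inj_on g {0..1} \<and>
        g 0 = x \<and> g 1 = x\<^sub>0 \<and>
        (\<forall>t \<in> {0..1}. curve_length (euclid n) g 0 t \<le> ennreal a * boundary_dist n D (g t)))"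

definition quasisymmetric ::
    "(real \<Rightarrow> real) \<Rightarrow> 'a metric \<Rightarrow> 'b metric \<Rightarrow> ('a \<Rightarrow> 'b) \<Rightarrow> bool" where
  "quasisymmetric \<eta> X Y f \<longleftrightarrow>
     homeomorphic_map (mtopology_of X) (mtopology_of Y) f \<and>
     (\<forall>t\<ge>0. \<forall>x \<in> mspace X. \<forall>a \<in> mspace X. \<forall>b \<in> mspace X.
        mdist X x a \<le> t * mdist X x b \<longrightarrow>
        mdist Y (f x) (f a) \<le> \<eta> t * mdist Y (f x) (f b))"

lemma Metric_space_euclid:
  fixes n :: nat
  shows "Metric_space {x. \<forall>i\<ge>n. x i = 0} (\<lambda>x y. sqrt (\<Sum>i<n. (x i - y i)\<^sup>2))"
proof
  fix x y :: "nat \<Rightarrow> real"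
  show "0 \<le> sqrt (\<Sum>i<n. (x i - y i)\<^sup>2)"
    by (simp add: sum_nonneg)
  show "sqrt (\<Sum>i<n. (x i - y i)\<^sup>2) = sqrt (\<Sum>i<n. (y i - x i)\<^sup>2)"
    by (simp add: power2_commute)
next
  fix x y :: "nat \<Rightarrow> real"
  assume "x \<in> {x. \<forall>i\<ge>n. x i = 0}" "y \<in> {x. \<forall>i\<ge>n. x i = 0}"
  then show "(sqrt (\<Sum>i<n. (x i - y i)\<^sup>2) = 0) = (x = y)"
    by (auto simp: sum_nonneg_eq_0_iff fun_eq_iff) (metis lessThan_iff not_le)
next
  fix x y z :: "nat \<Rightarrow> real"
  show "sqrt (\<Sum>i<n. (x i - z i)\<^sup>2) \<le> sqrt (\<Sum>i<n. (x i - y i)\<^sup>2) + sqrt (\<Sum>i<n. (y i - z i)\<^sup>2)"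
    using L2_set_triangle_ineq[of "\<lambda>i. x i - y i" "\<lambda>i. y i - z i" "{..<n}"]
    by (simp add: L2_set_def)
qed

lemma mspace_euclid [simp]: "mspace (euclid n) = {x. \<forall>i\<ge>n. x i = 0}"
  unfolding euclid_def by (rule Metric_space.mspace_metric[OF Metric_space_euclid])

lemma mdist_euclid: "mdist (euclid n) x y = sqrt (\<Sum>i<n. (x i - y i)\<^sup>2)"
  unfolding euclid_def by (simp add: Metric_space.mdist_metric[OF Metric_space_euclid])

lemma mtopology_of_euclid: "mtopology_of (euclid n) = Euclidean_space n"
proof -
  interpret E: Metric_space "mspace (euclid n)" "mdist (euclid n)"
    by (rule Metric_space_mspace_mdist)
  have top: "E.mtopology = mtopology_of (euclid n)"
    by (simp add: mtopology_of_def)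
  have coord: "\<bar>x i - y i\<bar> \<le> mdist (euclid n) x y" if "i < n" for x y i
  proof -
    have "\<bar>x i - y i\<bar> \<le> L2_set (\<lambda>i. \<bar>x i - y i\<bar>) {..<n}"
      by (rule member_le_L2_set) (use that in auto)
    then show ?thesis by (simp add: L2_set_def mdist_euclid)
  qed
  have le_sum: "mdist (euclid n) x y \<le> (\<Sum>i<n. \<bar>x i - y i\<bar>)" for x y
    using L2_set_le_sum_abs[of "\<lambda>i. x i - y i" "{..<n}"] by (simp add: L2_set_def mdist_euclid)
  have "continuous_map E.mtopology euclideanreal (\<lambda>x. x i)" for i
  proof (cases "i < n")
    case True
    have "continuous_map E.mtopology Met_TC.mtopology (\<lambda>x. x i)"
      unfolding E.metric_continuous_map[OF Met_TC.Metric_space_axioms]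
    proof (intro conjI ballI allI impI)
      fix a and e :: real
      assume "a \<in> mspace (euclid n)" "e > 0"
      then show "\<exists>d>0. \<forall>x. x \<in> mspace (euclid n) \<and> mdist (euclid n) a x < d \<longrightarrow> dist (a i) (x i) < e"
        using coord[OF True] by (intro exI[of _ e]) (auto simp: dist_real_def intro: le_less_trans)
    qed auto
    then show ?thesis by simp
  next
    case False
    show ?thesis
      by (rule continuous_map_eq[of _ _ "\<lambda>x. 0"])
         (use False in \<open>simp_all add: E.topspace_mtopology del: mspace_euclid\<close>, simp)
  qed
  then have 1: "continuous_map E.mtopology (Euclidean_space n) (\<lambda>x. x)"
    unfolding Euclidean_space_def continuous_map_in_subtopology
    by (simp add: continuous_map_componentwise_UNIV Pi_iff E.topspace_mtopology del: mspace_euclid)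
       simp
  have 2: "continuous_map (Euclidean_space n) E.mtopology (\<lambda>x. x)"
    unfolding E.continuous_map_to_metric
  proof (intro ballI allI impI)
    fix x and e :: real
    assume x: "x \<in> topspace (Euclidean_space n)" and e: "e > 0"
    define h where "h = (\<lambda>y::nat \<Rightarrow> real. \<Sum>i<n. \<bar>x i - y i\<bar>)"
    have "continuous_map (Euclidean_space n) euclideanreal h"
      unfolding h_def Euclidean_space_def
      by (intro continuous_map_from_subtopology continuous_intros) auto
    then have "openin (Euclidean_space n) {y \<in> topspace (Euclidean_space n). h y \<in> {..<e}}"
      by (rule openin_continuous_map_preimage) (simp flip: open_openin)
    moreover have "y \<in> E.mball x e" if "y \<in> topspace (Euclidean_space n)" "h y < e" for y
      unfolding E.in_mball
      using that x le_less_trans[OF le_sum] by (simp add: h_def topspace_Euclidean_space)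
    ultimately show "\<exists>U. openin (Euclidean_space n) U \<and> x \<in> U \<and> (\<forall>y\<in>U. y \<in> E.mball x e)"
      using x e
      by (intro exI[of _ "{y \<in> topspace (Euclidean_space n). h y \<in> {..<e}}"])
         (simp add: h_def del: mspace_euclid)
  qed
  have "homeomorphic_maps E.mtopology (Euclidean_space n) (\<lambda>x. x) (\<lambda>x. x)"
    using 1 2 by (simp add: homeomorphic_maps_def)
  then show ?thesis
    using homeomorphic_maps_id[of E.mtopology "Euclidean_space n"] top
    by (simp add: id_def)
qed

end

theory Submission
  imports Defs "HOL-Homology.Invariance_of_Domain"
begin

text \<open>
Quasisymmetric maps control ratios of distances but not lengths: the image of a rectifiable arc may have
infinite length. It is replaced by a broken line. Let the arc \<open>\<alpha>\<close> join \<open>x\<close> to \<open>x\<^sub>0\<close> in \<open>D\<close> with the carrot condition,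
parametrized by length. If \<open>d\<close> denotes the distance to the frontier of \<open>D\<close>, then \<open>d (\<alpha> s)\<close> is comparable to \<open>d x + s\<close>, so
\<open>\<alpha>\<close> can be cut at parameters where \<open>d x + s\<close> grows by a fixed factor slightly larger than \<open>1\<close>. The
images \<open>q i\<close> of the cut points then have three properties (\<open>quasisymmetric_image_chain\<close>):

\<^item> \<open>|q i - q (i + 1)|\<close> is at most half the distance from \<open>q i\<close> to the frontier of \<open>D'\<close>, so the segments
  between consecutive points stay in \<open>D'\<close>;
\<^item> the distance from \<open>q j\<close> to any earlier \<open>q i\<close> is at most \<open>\<eta> (2 * a)\<close> times the distance from \<open>q j\<close> to the
  frontier;
\<^item> the edge lengths are dominated by a geometric series, going backwards from any \<open>q j\<close>.

The last two give the carrot condition for the broken line, by its length. The number of cut points per scale is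
bounded by the length of \<open>\<alpha>\<close>, whereas covering arguments in \<open>\<real>\<^sup>n\<close> would bring in a constant that depends on
the dimension. This is where it matters that \<open>D\<close> is a John domain in the sense of length. Erasing the loops of the broken
line makes it an arc and does not increase lengths (\<open>injective_curve_along_chain\<close>,
\<open>John_arc_along_chain\<close>).

To pass from distances between points of \<open>D'\<close> to distances to its frontier,
\<open>quasisymmetric_dist_le_frontier\<close> uses that closed balls contained in \<open>D\<close> have compact images. That \<open>D'\<close> is open is
the invariance of domain.
\<close>

section \<open>Lengths of curves and parametrization by length\<close>

lemma curve_length_add_chord:
  assumes "0 \<le> s" "s \<le> t"
  shows "curve_length m g 0 s + ennreal (mdist m (g s) (g t)) \<le> curve_length m g 0 t"
proof -
  define V where "V p = (\<Sum>i<length p - 1. mdist m (g (p ! i)) (g (p ! Suc i)))" for p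
  have "ennreal (V p) + ennreal (mdist m (g s) (g t)) \<le> curve_length m g 0 t"
    if p: "sorted p" "set p \<subseteq> {0..s}" for p
  proof -
    let ?q = "p @ [s, t]"
    have "sorted ?q" "set ?q \<subseteq> {0..t}"
      using p assms by (auto simp: sorted_append)
    then have "ennreal (V ?q) \<le> curve_length m g 0 t"
      unfolding curve_length_def V_def by (intro SUP_upper) auto
    moreover have "V p + mdist m (g s) (g t) \<le> V ?q"
    proof -
      have "V p = (\<Sum>i<length p - 1. mdist m (g (?q ! i)) (g (?q ! Suc i)))"
        unfolding V_def by (intro sum.cong) (auto simp: nth_append)
      also have "\<dots> \<le> (\<Sum>i<length p. mdist m (g (?q ! i)) (g (?q ! Suc i)))"
        by (intro sum_mono2) auto
      finally show ?thesis
        by (simp add: V_def nth_append)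
    qed
    moreover have "0 \<le> V p"
      by (simp add: V_def sum_nonneg)
    ultimately show ?thesis
      using ennreal_leI[of "V p + mdist m (g s) (g t)" "V ?q"] by (simp add: ennreal_plus)
  qed
  moreover have "curve_length m g 0 s + ennreal (mdist m (g s) (g t))
      = (SUP p \<in> {p. sorted p \<and> set p \<subseteq> {0..s}}. ennreal (V p) + ennreal (mdist m (g s) (g t)))"
  proof -
    have "{p. sorted p \<and> set p \<subseteq> {0..s}} \<noteq> {}"
      by (auto intro!: exI[of _ "[]"])
    then show ?thesis
      unfolding curve_length_def V_def by (simp add: ennreal_SUP_add_left)
  qed
  ultimately show ?thesis
    by (auto intro: SUP_least)
qed

lemma curve_length_Lipschitz_le:
  assumes "0 \<le> C" "0 \<le> t"
    and lip: "\<And>r s. 0 \<le> r \<Longrightarrow> r \<le> s \<Longrightarrow> s \<le> t \<Longrightarrow> mdist m (g r) (g s) \<le> C * (s - r)"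
  shows "curve_length m g 0 t \<le> ennreal (C * t)"
  unfolding curve_length_def
proof (intro SUP_least ennreal_leI, clarify)
  fix p :: "real list"
  assume p: "sorted p" "set p \<subseteq> {0..t}"
  have "(\<Sum>i<length p - 1. mdist m (g (p ! i)) (g (p ! Suc i)))
      \<le> (\<Sum>i<length p - 1. C * (p ! Suc i - p ! i))"
  proof (intro sum_mono lip)
    fix i assume i: "i \<in> {..<length p - 1}"
    then have "p ! i \<in> set p" "p ! Suc i \<in> set p"
      by auto
    with p(2) have "p ! i \<in> {0..t}" "p ! Suc i \<in> {0..t}"
      by blast+
    with p(1) i show "0 \<le> p ! i" "p ! i \<le> p ! Suc i" "p ! Suc i \<le> t"
      by (auto simp: sorted_iff_nth_mono)
  qed
  also have "\<dots> = C * (p ! (length p - 1) - p ! 0)"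
    by (simp add: sum_lessThan_telescope flip: sum_distrib_left)
  also have "\<dots> \<le> C * t"
  proof (cases p)
    case (Cons b q)
    then have "p ! (length p - 1) \<in> set p" "p ! 0 \<in> set p"
      using nth_mem[of "length p - 1" p] by simp_all
    with p(2) have "p ! (length p - 1) \<in> {0..t}" "p ! 0 \<in> {0..t}"
      by blast+
    with \<open>0 \<le> C\<close> show ?thesis
      by (intro mult_left_mono) auto
  qed (use assms in simp)
  finally show "(\<Sum>i<length p - 1. mdist m (g (p ! i)) (g (p ! Suc i))) \<le> C * t" .
qed

lemma right_limit_le:
  fixes \<phi> :: "real \<Rightarrow> real"
  assumes "continuous_on {0..1} \<phi>" "0 \<le> \<tau>" "\<tau> < b" "b \<le> 1"
    and "\<And>t. \<tau> < t \<Longrightarrow> t < b \<Longrightarrow> \<phi> t \<le> c"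
  shows "\<phi> \<tau> \<le> c"
proof (rule continuous_le_on_closure[where f = \<phi> and S = "{\<tau><..<b}"])
  show "continuous_on (closure {\<tau><..<b}) \<phi>"
    using assms(1) by (rule continuous_on_subset) (use assms(2-4) in auto)
  show "\<tau> \<in> closure {\<tau><..<b}"
    using assms(3) by simp
  show "\<phi> t \<le> c" if "t \<in> {\<tau><..<b}" for t
    using assms(5)[of t] that by simp
qed

lemma left_limit_le:
  fixes \<phi> :: "real \<Rightarrow> real"
  assumes "continuous_on {0..1} \<phi>" "0 \<le> b" "b < \<tau>" "\<tau> \<le> 1"
    and "\<And>t. b < t \<Longrightarrow> t < \<tau> \<Longrightarrow> \<phi> t \<le> c"
  shows "\<phi> \<tau> \<le> c"
proof (rule continuous_le_on_closure[where f = \<phi> and S = "{b<..<\<tau>}"])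
  show "continuous_on (closure {b<..<\<tau>}) \<phi>"
    using assms(1) by (rule continuous_on_subset) (use assms(2-4) in auto)
  show "\<tau> \<in> closure {b<..<\<tau>}"
    using assms(3) by simp
  show "\<phi> t \<le> c" if "t \<in> {b<..<\<tau>}" for t
    using assms(5)[of t] that by simp
qed

text \<open>
A rectifiable curve becomes \<open>1\<close>-Lipschitz when it is parametrized by its length \<open>L\<close>: the new
parameter \<open>s\<close> is sent to the point at the last time \<open>\<tau> s = Sup {t. L t \<le> s}\<close> at which the length has
not exceeded \<open>s\<close>. Since \<open>L > s\<close> after \<open>\<tau> s\<close> and \<open>L \<le> s'\<close> before \<open>\<tau> s'\<close>, chords between such times are at
most \<open>s' - s\<close>, and this closed condition passes to the limit because \<open>g\<close> is continuous. For the same reason a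
bound \<open>L t \<le> h (g t)\<close> turns into \<open>s \<le> h (\<gamma> s)\<close>.
\<close>

lemma one_Lipschitz_reparametrization:
  fixes m :: "'a metric" and L :: "real \<Rightarrow> real"
  assumes cont: "continuous_map (top_of_set {0..1}) (mtopology_of m) g"
    and L0: "L 0 = 0"
    and chord: "\<And>s t. 0 \<le> s \<Longrightarrow> s \<le> t \<Longrightarrow> t \<le> 1 \<Longrightarrow> mdist m (g s) (g t) \<le> L t - L s"
    and h: "continuous_map (mtopology_of m) euclideanreal h"
    and Lh: "\<And>t. 0 \<le> t \<Longrightarrow> t \<le> 1 \<Longrightarrow> L t \<le> h (g t)"
  obtains \<gamma> where "\<gamma> ` {0..L 1} \<subseteq> g ` {0..1}" "\<gamma> 0 = g 0" "\<gamma> (L 1) = g 1"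
    "\<And>s s'. 0 \<le> s \<Longrightarrow> s \<le> s' \<Longrightarrow> s' \<le> L 1 \<Longrightarrow> mdist m (\<gamma> s) (\<gamma> s') \<le> s' - s"
    "\<And>s. 0 \<le> s \<Longrightarrow> s \<le> L 1 \<Longrightarrow> s \<le> h (\<gamma> s)"
proof -
  have mono: "L s \<le> L t" if "0 \<le> s" "s \<le> t" "t \<le> 1" for s t
    using chord[OF that] mdist_nonneg[of m "g s" "g t"] by linarith
  have g_in: "g t \<in> mspace m" if "0 \<le> t" "t \<le> 1" for t
    using continuous_map_image_subset_topspace[OF cont] that by auto
  define B where "B s = {t \<in> {0..1}. L t \<le> s}" for s
  define \<tau> where "\<tau> s = Sup (B s)" for s
  have bdd: "bdd_above (B s)" for s
    unfolding B_def by (auto intro: bdd_aboveI)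
  have zero: "0 \<in> B s" if "0 \<le> s" for s
    using that L0 by (simp add: B_def)
  have \<tau>0: "0 \<le> \<tau> s" if "0 \<le> s" for s
    unfolding \<tau>_def using zero[OF that] bdd by (rule cSup_upper)
  have \<tau>1: "\<tau> s \<le> 1" if "0 \<le> s" for s
    unfolding \<tau>_def using zero[OF that] by (intro cSup_least) (blast, simp add: B_def)
  have \<tau>_mono: "\<tau> s \<le> \<tau> s'" if "0 \<le> s" "s \<le> s'" for s s'
    unfolding \<tau>_def using zero[OF that(1)] that
    by (intro cSup_subset_mono bdd) (blast, auto simp: B_def)
  have above: "s < L t" if "0 \<le> s" "\<tau> s < t" "t \<le> 1" for s t
  proof (rule ccontr)
    assume "\<not> s < L t"
    then have "t \<in> B s"
      using that \<tau>0[OF that(1)] by (simp add: B_def)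
    then show False
      using cSup_upper[OF _ bdd, of t s] that(2) by (simp add: \<tau>_def)
  qed
  have below: "L t \<le> s" if st: "0 \<le> s" "0 \<le> t" "t < \<tau> s" for s t
  proof -
    have "\<exists>u\<in>B s. t < u"
      using st(3) zero[OF st(1)] less_cSup_iff[OF _ bdd, of s t] unfolding \<tau>_def by blast
    then obtain u where "u \<in> B s" "t < u"
      by blast
    then show ?thesis
      using mono[of t u] st by (auto simp: B_def)
  qed
  have cont_dist: "continuous_on {0..1} (\<lambda>t. mdist m (g t) (g t'))" if "0 \<le> t'" "t' \<le> 1" for t'
  proof -
    have "continuous_map (top_of_set {0..1}) euclidean (\<lambda>t. mdist m (g t) (g t'))"
      using g_in[OF that] by (intro continuous_map_mdist cont) auto
    then show ?thesis
      by (simp add: continuous_map_iff_continuous)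
  qed
  have cont_h: "continuous_on {0..1} (\<lambda>t. h (g t))"
    using continuous_map_compose[OF cont h] by (simp add: continuous_map_iff_continuous o_def)
  have lip: "mdist m (g (\<tau> s)) (g (\<tau> s')) \<le> s' - s" if "0 \<le> s" "s \<le> s'" for s s'
  proof (cases "\<tau> s = \<tau> s'")
    case True
    have "0 \<le> s'"
      using that by simp
    then have "mdist m (g (\<tau> s)) (g (\<tau> s')) = 0"
      using True g_in[OF \<tau>0 \<tau>1, of s'] by simp
    then show ?thesis
      using that by simp
  next
    case False
    then have less: "\<tau> s < \<tau> s'"
      using \<tau>_mono[OF that] by simp
    have "0 \<le> s'"
      using that by simp
    note bounds = \<tau>0[OF \<open>0 \<le> s\<close>] \<tau>1[OF \<open>0 \<le> s'\<close>]
    have *: "mdist m (g t) (g t') \<le> s' - s" if "\<tau> s < t" "t < t'" "t' < \<tau> s'" for t t'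
      using chord[of t t'] above[of s t] below[of s' t'] that bounds \<open>0 \<le> s\<close> \<open>s \<le> s'\<close> by simp
    have **: "mdist m (g t) (g (\<tau> s')) \<le> s' - s" if t: "\<tau> s < t" "t < \<tau> s'" for t
    proof -
      have "mdist m (g (\<tau> s')) (g t) \<le> s' - s"
      proof (rule left_limit_le[OF cont_dist, of t t "\<tau> s'"])
        show "mdist m (g t') (g t) \<le> s' - s" if "t < t'" "t' < \<tau> s'" for t'
          using *[OF t(1) that] by (simp add: mdist_commute[of m "g t'"])
      qed (use t bounds in auto)
      then show ?thesis
        by (simp add: mdist_commute[of m "g t"])
    qed
    show ?thesis
    proof (rule right_limit_le[OF cont_dist, of "\<tau> s'" "\<tau> s" "\<tau> s'"])
      show "0 \<le> \<tau> s'"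
        using less bounds by simp
    qed (use less bounds ** in blast)+
  qed
  have L1: "0 \<le> L 1"
    using mono[of 0 1] L0 by simp
  show thesis
  proof
    show "(\<lambda>s. g (\<tau> s)) ` {0..L 1} \<subseteq> g ` {0..1}"
    proof (clarify, rule imageI)
      fix s assume "s \<in> {0..L 1}"
      then show "\<tau> s \<in> {0..1}"
        using \<tau>0[of s] \<tau>1[of s] by simp
    qed
    show "g (\<tau> (L 1)) = g 1"
    proof -
      have "1 \<in> B (L 1)"
        by (simp add: B_def)
      then have "1 \<le> \<tau> (L 1)"
        unfolding \<tau>_def by (intro cSup_upper bdd)
      then show ?thesis
        using \<tau>1[OF L1] by simp
    qed
    show "g (\<tau> 0) = g 0"
    proof (cases "\<tau> 0 = 0")
      case False
      then have pos: "0 < \<tau> 0"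
        using \<tau>0[of 0] by simp
      have "mdist m (g (\<tau> 0)) (g 0) \<le> 0"
      proof (rule left_limit_le[OF cont_dist, of 0 0 "\<tau> 0"])
        fix t assume "0 < t" "t < \<tau> 0"
        then show "mdist m (g t) (g 0) \<le> 0"
          using chord[of 0 t] below[of 0 t] L0 \<tau>1[of 0] by (simp add: mdist_commute[of m "g t"])
      qed (use pos \<tau>1[of 0] in auto)
      then have "mdist m (g (\<tau> 0)) (g 0) = 0"
        by (simp add: antisym)
      then show ?thesis
        using g_in[of 0] g_in[OF \<tau>0 \<tau>1, of 0] by simp
    qed simp
    show "mdist m (g (\<tau> s)) (g (\<tau> s')) \<le> s' - s" if "0 \<le> s" "s \<le> s'" "s' \<le> L 1" for s s'
      using lip that by blast
    show "s \<le> h (g (\<tau> s))" if s: "0 \<le> s" "s \<le> L 1" for s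
    proof (cases "\<tau> s = 1")
      case True
      then show ?thesis
        using s Lh[of 1] by simp
    next
      case False
      then have less: "\<tau> s < 1"
        using \<tau>1[OF s(1)] by simp
      have "- h (g (\<tau> s)) \<le> - s"
      proof (rule right_limit_le[of "\<lambda>t. - h (g t)" "\<tau> s" 1])
        show "continuous_on {0..1} (\<lambda>t. - h (g t))"
          by (intro continuous_intros cont_h)
        show "- h (g t) \<le> - s" if "\<tau> s < t" "t < 1" for t
          using above[of s t] Lh[of t] that s \<tau>0[of s] by simp
      qed (use \<tau>0[OF s(1)] less in auto)
      then show ?thesis
        by simp
    qed
  qed
qed

lemma continuous_map_of_Lipschitz:
  fixes \<gamma> :: "real \<Rightarrow> 'a"
  assumes "\<gamma> ` {a..b} \<subseteq> mspace m"
    and lip: "\<And>s t. a \<le> s \<Longrightarrow> s \<le> t \<Longrightarrow> t \<le> b \<Longrightarrow> mdist m (\<gamma> s) (\<gamma> t) \<le> C * (t - s)"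
  shows "continuous_map (top_of_set {a..b}) (mtopology_of m) \<gamma>"
proof -
  have "mdist m (\<gamma> s) (\<gamma> t) \<le> C * dist s t" if "s \<in> {a..b}" "t \<in> {a..b}" for s t
  proof (cases "s \<le> t")
    case True
    then show ?thesis
      using lip[of s t] that by (simp add: dist_real_def)
  next
    case False
    then show ?thesis
      using lip[of t s] that by (simp add: dist_real_def mdist_commute[of m "\<gamma> s"])
  qed
  then have "Lipschitz_continuous_map (submetric euclidean_metric {a..b}) m \<gamma>"
    using assms(1) unfolding Lipschitz_continuous_map_def by (auto intro!: exI[of _ C])
  then show ?thesis
    using Lipschitz_continuous_imp_continuous_map mtopology_of_submetric mtopology_of_euclidean by metis
qed

section \<open>Injective curves along chains of geodesics\<close>

definition geodesic :: "'a metric \<Rightarrow> (real \<Rightarrow> 'a) \<Rightarrow> real \<Rightarrow> bool" where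
  "geodesic m \<sigma> l \<longleftrightarrow>
     0 \<le> l \<and> \<sigma> ` {0..l} \<subseteq> mspace m \<and>
     (\<forall>s\<in>{0..l}. \<forall>t\<in>{0..l}. mdist m (\<sigma> s) (\<sigma> t) = \<bar>s - t\<bar>)"

lemma geodesic_continuous:
  "geodesic m \<sigma> l \<Longrightarrow> continuous_map (top_of_set {0..l}) (mtopology_of m) \<sigma>"
  by (rule continuous_map_of_Lipschitz[where C = 1]) (auto simp: geodesic_def)

lemma last_parameter_in_compact:
  fixes \<sigma> :: "real \<Rightarrow> 'a"
  assumes \<sigma>: "continuous_map (top_of_set {0..l}) (mtopology_of m) \<sigma>" and "0 \<le> l"
    and K: "compactin (mtopology_of m) K" and "\<sigma> 0 \<in> K"
  obtains u where "0 \<le> u" "u \<le> l" "\<sigma> u \<in> K" "\<And>s. u < s \<Longrightarrow> s \<le> l \<Longrightarrow> \<sigma> s \<notin> K"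
proof -
  define S where "S = {s \<in> {0..l}. \<sigma> s \<in> K}"
  have "Hausdorff_space (mtopology_of m)"
    unfolding mtopology_of_def
    by (rule Metric_space.Hausdorff_space_mtopology[OF Metric_space_mspace_mdist])
  then have "closedin (mtopology_of m) K"
    using K by (rule compactin_imp_closedin)
  then have "closedin (top_of_set {0..l}) {s \<in> topspace (top_of_set {0..l}). \<sigma> s \<in> K}"
    by (rule closedin_continuous_map_preimage[OF \<sigma>])
  then have "compact S"
    unfolding S_def using closedin_compact[OF compact_Icc] by simp
  moreover have "0 \<in> S"
    using assms by (simp add: S_def)
  ultimately obtain u where u: "u \<in> S" "\<And>s. s \<in> S \<Longrightarrow> s \<le> u"
    using compact_attains_sup[of S] by blast
  show thesis
  proof
    show "0 \<le> u" "u \<le> l" "\<sigma> u \<in> K"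
      using u(1) by (auto simp: S_def)
    show "\<sigma> s \<notin> K" if "u < s" "s \<le> l" for s
      using u(2)[of s] that \<open>0 \<le> u\<close> by (auto simp: S_def)
  qed
qed

text \<open>
A broken geodesic may cross itself, but arcs have to be injective. Loops are erased one edge at a time: the
curve \<open>\<beta>\<close> built so far is followed only up to the point where the new edge meets it for the last time,
and from there on the new edge is followed. The result is injective, and it is again \<open>1\<close>-Lipschitz
because both pieces are. Cutting loops only shortens the way, so a point reached at time \<open>t\<close>
lies on some edge \<open>i\<close> with \<open>t\<close> at most the total length of the edges up to \<open>i\<close>. The case \<open>T = 0\<close>,
in which the chain returns to its starting point, has to be admitted for the induction.
\<close>

lemma injective_curve_along_chain:
  fixes m :: "'a metric"
  assumes "v 0 \<in> mspace m"
    and "\<And>i. i < N \<Longrightarrow> geodesic m (\<sigma> i) (l i) \<and> \<sigma> i 0 = v i \<and> \<sigma> i (l i) = v (Suc i)"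
  shows "\<exists>T \<beta>. 0 \<le> T \<and> T \<le> (\<Sum>k<N. l k) \<and> \<beta> ` {0..T} \<subseteq> mspace m \<and> inj_on \<beta> {0..T} \<and>
           \<beta> 0 = v 0 \<and> \<beta> T = v N \<and>
           (\<forall>s t. 0 \<le> s \<longrightarrow> s \<le> t \<longrightarrow> t \<le> T \<longrightarrow> mdist m (\<beta> s) (\<beta> t) \<le> t - s) \<and>
           (\<forall>t. 0 < t \<longrightarrow> t \<le> T \<longrightarrow> (\<exists>i<N. \<beta> t \<in> \<sigma> i ` {0..l i} \<and> t \<le> (\<Sum>k\<le>i. l k)))"
  using assms(2)
proof (induction N)
  case 0
  have "mdist m (v 0) (v 0) = 0"
    using assms(1) by simp
  then have "mdist m (v 0) (v 0) \<le> t - s" if "s \<le> t" for s t :: real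
    using that by linarith
  then show ?case
    using assms(1) by (intro exI[of _ 0] exI[of _ "\<lambda>_. v 0"]) auto
next
  case (Suc N)
  obtain T \<beta> where T: "0 \<le> T" "T \<le> (\<Sum>k<N. l k)" and \<beta>_in: "\<beta> ` {0..T} \<subseteq> mspace m"
    and inj: "inj_on \<beta> {0..T}" and ends: "\<beta> 0 = v 0" "\<beta> T = v N"
    and lip: "\<And>s t. 0 \<le> s \<Longrightarrow> s \<le> t \<Longrightarrow> t \<le> T \<Longrightarrow> mdist m (\<beta> s) (\<beta> t) \<le> t - s"
    and on: "\<And>t. 0 < t \<Longrightarrow> t \<le> T \<Longrightarrow> \<exists>i<N. \<beta> t \<in> \<sigma> i ` {0..l i} \<and> t \<le> (\<Sum>k\<le>i. l k)"
    using Suc.IH Suc.prems by (metis less_Suc_eq)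
  let ?\<sigma> = "\<sigma> N" and ?l = "l N"
  have geo: "geodesic m ?\<sigma> ?l" and \<sigma>_ends: "?\<sigma> 0 = v N" "?\<sigma> ?l = v (Suc N)"
    using Suc.prems[of N] by auto
  have l0: "0 \<le> ?l" and \<sigma>_in: "\<And>s. 0 \<le> s \<Longrightarrow> s \<le> ?l \<Longrightarrow> ?\<sigma> s \<in> mspace m"
    and \<sigma>_dist: "\<And>s t. 0 \<le> s \<Longrightarrow> s \<le> t \<Longrightarrow> t \<le> ?l \<Longrightarrow> mdist m (?\<sigma> s) (?\<sigma> t) = t - s"
    using geo by (auto simp: geodesic_def)
  have "continuous_map (top_of_set {0..T}) (mtopology_of m) \<beta>"
    using \<beta>_in lip by (intro continuous_map_of_Lipschitz[where C = 1]) auto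
  then have "compactin (mtopology_of m) (\<beta> ` {0..T})"
    by (rule image_compactin[rotated]) (simp add: compactin_subtopology)
  moreover have "?\<sigma> 0 \<in> \<beta> ` {0..T}"
    using \<sigma>_ends ends T by force
  ultimately obtain u where u: "0 \<le> u" "u \<le> ?l" "?\<sigma> u \<in> \<beta> ` {0..T}"
    and off: "\<And>s. u < s \<Longrightarrow> s \<le> ?l \<Longrightarrow> ?\<sigma> s \<notin> \<beta> ` {0..T}"
    using last_parameter_in_compact[OF geodesic_continuous[OF geo] l0] by metis
  \<comment> \<open>the time at which \<open>\<beta>\<close> passes through the last common point \<open>?\<sigma> u\<close>\<close>
  obtain c where c: "0 \<le> c" "c \<le> T" "\<beta> c = ?\<sigma> u"
    using u(3) by auto
  define T' where "T' = c + (?l - u)"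
  define \<beta>' where "\<beta>' t = (if t \<le> c then \<beta> t else ?\<sigma> (u + (t - c)))" for t
  have old: "\<beta>' t = \<beta> t" if "t \<le> c" for t
    using that by (simp add: \<beta>'_def)
  have new: "\<beta>' t = ?\<sigma> (u + (t - c))" if "c \<le> t" for t
    using that c by (cases "t = c") (simp_all add: \<beta>'_def)
  have "c \<le> T'"
    using u by (simp add: T'_def)
  have in': "\<beta>' t \<in> mspace m" if "0 \<le> t" "t \<le> T'" for t
    using that c u \<beta>_in \<sigma>_in[of "u + (t - c)"] by (auto simp: \<beta>'_def T'_def)
  have sum: "T + ?l \<le> (\<Sum>k\<le>N. l k)"
    using T(2) by (simp flip: lessThan_Suc_atMost)
  show ?case
  proof (intro exI[of _ T'] exI[of _ \<beta>'] conjI allI impI)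
    show "0 \<le> T'" "T' \<le> (\<Sum>k<Suc N. l k)"
      using c u T by (auto simp: T'_def)
    show "\<beta>' ` {0..T'} \<subseteq> mspace m"
      using in' by auto
    show "\<beta>' 0 = v 0" "\<beta>' T' = v (Suc N)"
      using old[of 0] new[of T'] c ends \<sigma>_ends \<open>c \<le> T'\<close> by (auto simp: T'_def)
    show "inj_on \<beta>' {0..T'}"
    proof (rule linorder_inj_onI')
      fix s t assume st: "s \<in> {0..T'}" "t \<in> {0..T'}" "s < t"
      consider "t \<le> c" | "s \<le> c" "c < t" | "c < s"
        by linarith
      then show "\<beta>' s \<noteq> \<beta>' t"
      proof cases
        case 1
        then show ?thesis
          using old[of s] old[of t] st c inj_onD[OF inj, of s t] by auto
      next
        case 2
        then have "\<beta>' s \<in> \<beta> ` {0..T}" "\<beta>' t \<notin> \<beta> ` {0..T}"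
          using old[of s] new[of t] st c off[of "u + (t - c)"] by (auto simp: T'_def)
        then show ?thesis
          by metis
      next
        case 3
        then have "mdist m (\<beta>' s) (\<beta>' t) = t - s"
          using new[of s] new[of t] \<sigma>_dist[of "u + (s - c)" "u + (t - c)"] st u
          by (simp add: T'_def)
        then show ?thesis
          using in'[of s] in'[of t] st mdist_zero[of "\<beta>' s" m "\<beta>' t"] by auto
      qed
    qed
    show "mdist m (\<beta>' s) (\<beta>' t) \<le> t - s" if st: "0 \<le> s" "s \<le> t" "t \<le> T'" for s t
    proof -
      have early: "mdist m (\<beta>' r) (\<beta>' t) \<le> t - r" if "0 \<le> r" "r \<le> t" "t \<le> c" for r t
        using old[of r] old[of t] lip[of r t] that c by simp
      have late: "mdist m (\<beta>' r) (\<beta>' t) \<le> t - r" if "c \<le> r" "r \<le> t" "t \<le> T'" for r t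
        using new[of r] new[of t] \<sigma>_dist[of "u + (r - c)" "u + (t - c)"] u that
        by (simp add: T'_def)
      consider "t \<le> c" | "s \<le> c" "c \<le> t" | "c \<le> s"
        by linarith
      then show ?thesis
      proof cases
        case 2
        have "mdist m (\<beta>' s) (\<beta>' t) \<le> mdist m (\<beta>' s) (\<beta>' c) + mdist m (\<beta>' c) (\<beta>' t)"
          using 2 st c by (intro mdist_triangle in') auto
        then show ?thesis
          using early[of s c] late[of c t] 2 st by simp
      qed (use early late st in auto)
    qed
    show "\<exists>i<Suc N. \<beta>' t \<in> \<sigma> i ` {0..l i} \<and> t \<le> (\<Sum>k\<le>i. l k)" if t: "0 < t" "t \<le> T'" for t
    proof (cases "t \<le> c")
      case True
      then show ?thesis
        using old[of t] on[of t] t c by (auto intro: less_SucI)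
    next
      case False
      then have "\<beta>' t \<in> ?\<sigma> ` {0..?l}"
        using new[of t] t u by (auto simp: T'_def)
      moreover have "t \<le> (\<Sum>k\<le>N. l k)"
        using sum t c u by (simp add: T'_def)
      ultimately show ?thesis
        by blast
    qed
  qed
qed

section \<open>Distance to a set\<close>

definition dist_to :: "'a metric \<Rightarrow> 'a set \<Rightarrow> 'a \<Rightarrow> real" where
  "dist_to m F z = (INF w\<in>F. mdist m z w)"

lemma dist_to_le: "w \<in> F \<Longrightarrow> dist_to m F z \<le> mdist m z w"
  unfolding dist_to_def by (rule cINF_lower) (auto intro: bdd_belowI2[where m = 0])

lemma dist_to_greatest:
  "F \<noteq> {} \<Longrightarrow> (\<And>w. w \<in> F \<Longrightarrow> c \<le> mdist m z w) \<Longrightarrow> c \<le> dist_to m F z"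
  unfolding dist_to_def by (rule cINF_greatest)

lemma dist_to_triangle:
  assumes "F \<noteq> {}" "F \<subseteq> mspace m" "y \<in> mspace m" "z \<in> mspace m"
  shows "dist_to m F y \<le> mdist m y z + dist_to m F z"
proof -
  have "dist_to m F y - mdist m y z \<le> dist_to m F z"
  proof (rule dist_to_greatest[OF assms(1)])
    fix w assume "w \<in> F"
    then show "dist_to m F y - mdist m y z \<le> mdist m z w"
      using dist_to_le[of w F m y] mdist_triangle[of y m z w] assms by auto
  qed
  then show ?thesis
    by simp
qed

lemma continuous_map_dist_to:
  assumes "F \<noteq> {}" "F \<subseteq> mspace m"
  shows "continuous_map (mtopology_of m) euclideanreal (dist_to m F)"
proof -
  have "dist (dist_to m F y) (dist_to m F z) \<le> 1 * mdist m y z"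
    if "y \<in> mspace m" "z \<in> mspace m" for y z
    using dist_to_triangle[OF assms that] dist_to_triangle[OF assms that(2,1)]
    by (simp add: dist_real_def abs_le_iff mdist_commute[of m z])
  then have "Lipschitz_continuous_map m euclidean_metric (dist_to m F)"
    unfolding Lipschitz_continuous_map_def by (auto intro!: exI[of _ 1])
  then show ?thesis
    using Lipschitz_continuous_imp_continuous_map by fastforce
qed

lemma dist_to_pos:
  assumes "openin (mtopology_of m) U" "z \<in> U" "U \<inter> F = {}" "F \<noteq> {}" "F \<subseteq> mspace m"
  shows "0 < dist_to m F z"
proof -
  interpret Metric_space "mspace m" "mdist m"
    by (rule Metric_space_mspace_mdist)
  obtain r where "0 < r" "mball z r \<subseteq> U"
    using assms(1,2) unfolding mtopology_of_def openin_mtopology by blast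
  have "r \<le> mdist m z w" if "w \<in> F" for w
  proof (rule ccontr)
    assume "\<not> r \<le> mdist m z w"
    moreover have "z \<in> mspace m" "w \<in> mspace m"
      using openin_subset[OF assms(1)] assms that by auto
    ultimately have "w \<in> mball z r"
      by simp
    then show False
      using \<open>mball z r \<subseteq> U\<close> assms(3) that by blast
  qed
  then show ?thesis
    using dist_to_greatest[OF assms(4), of r m z] \<open>0 < r\<close> by simp
qed

section \<open>Balls, segments and domains in Euclidean space\<close>

definition segment_param :: "nat \<Rightarrow> (nat \<Rightarrow> real) \<Rightarrow> (nat \<Rightarrow> real) \<Rightarrow> real \<Rightarrow> nat \<Rightarrow> real" where
  "segment_param n x y s = (\<lambda>i. x i + s / mdist (euclid n) x y * (y i - x i))"

lemma segment_param_ends: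
  assumes "x \<in> mspace (euclid n)" "y \<in> mspace (euclid n)"
  shows "segment_param n x y 0 = x" "segment_param n x y (mdist (euclid n) x y) = y"
proof -
  show "segment_param n x y (mdist (euclid n) x y) = y"
  proof (cases "mdist (euclid n) x y = 0")
    case True
    then have "x = y"
      using mdist_zero[OF assms] by (rule iffD1[rotated])
    then show ?thesis
      by (simp add: segment_param_def fun_eq_iff)
  next
    case False
    then show ?thesis
      by (simp add: segment_param_def fun_eq_iff)
  qed
qed (simp add: segment_param_def)

lemma geodesic_segment_param:
  assumes "x \<in> mspace (euclid n)" "y \<in> mspace (euclid n)"
  shows "geodesic (euclid n) (segment_param n x y) (mdist (euclid n) x y)"
  unfolding geodesic_def
proof (intro conjI ballI)
  let ?d = "mdist (euclid n) x y"
  show "segment_param n x y ` {0..?d} \<subseteq> mspace (euclid n)"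
    using assms by (auto simp: segment_param_def)
  show "mdist (euclid n) (segment_param n x y s) (segment_param n x y t) = \<bar>s - t\<bar>"
    if "s \<in> {0..?d}" "t \<in> {0..?d}" for s t
  proof -
    have "segment_param n x y s i - segment_param n x y t i = (s - t) / ?d * (y i - x i)" for i
      by (simp add: segment_param_def diff_divide_distrib left_diff_distrib)
    then have "mdist (euclid n) (segment_param n x y s) (segment_param n x y t)
        = sqrt (\<Sum>i<n. ((s - t) / ?d)\<^sup>2 * (x i - y i)\<^sup>2)"
      by (simp only: mdist_euclid[of n "segment_param n x y s"] power_mult_distrib
            power2_commute[of "y _" "x _"])
    also have "\<dots> = \<bar>(s - t) / ?d\<bar> * sqrt (\<Sum>i<n. (x i - y i)\<^sup>2)"
      by (simp only: real_sqrt_mult real_sqrt_abs flip: sum_distrib_left)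
    also have "\<dots> = \<bar>(s - t) / ?d\<bar> * ?d"
      by (simp only: mdist_euclid)
    also have "\<dots> = \<bar>s - t\<bar>"
    proof (cases "?d = 0")
      case True
      then have "s = t"
        using that unfolding True by simp
      then show ?thesis
        by simp
    next
      case False
      then show ?thesis
        using mdist_nonneg[of "euclid n" x y] by (simp add: abs_divide)
    qed
    finally show ?thesis .
  qed
qed simp

text \<open>
The segment from \<open>z\<close> to \<open>u\<close> is connected, so it could leave \<open>D\<close> only through a frontier point, which would
be within distance \<open>r\<close> of \<open>z\<close>.
\<close>

lemma euclid_cball_subset:
  assumes D: "D \<subseteq> mspace (euclid n)" and "z \<in> D"
    and far: "\<And>w. w \<in> mtopology_of (euclid n) frontier_of D \<Longrightarrow> r < mdist (euclid n) z w"
    and u: "u \<in> mspace (euclid n)" "mdist (euclid n) z u \<le> r"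
  shows "u \<in> D"
proof (rule ccontr)
  assume "u \<notin> D"
  let ?X = "mtopology_of (euclid n)" and ?\<sigma> = "segment_param n z u"
    and ?l = "mdist (euclid n) z u"
  have z: "z \<in> mspace (euclid n)"
    using assms by blast
  note ends = segment_param_ends[OF z u(1)] and geo = geodesic_segment_param[OF z u(1)]
  have "connectedin ?X (?\<sigma> ` {0..?l})"
    by (rule connectedin_continuous_map_image[OF geodesic_continuous[OF geo]])
       (simp add: connectedin_subtopology)
  moreover have "z \<in> ?\<sigma> ` {0..?l}" "u \<in> ?\<sigma> ` {0..?l}"
    using ends imageI[of 0 "{0..?l}" ?\<sigma>] imageI[of ?l "{0..?l}" ?\<sigma>] by simp_all
  then have "?\<sigma> ` {0..?l} \<inter> D \<noteq> {}" "?\<sigma> ` {0..?l} - D \<noteq> {}"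
    using \<open>z \<in> D\<close> \<open>u \<notin> D\<close> by blast+
  ultimately have "?\<sigma> ` {0..?l} \<inter> ?X frontier_of D \<noteq> {}"
    by (rule connectedin_Int_frontier_of)
  then obtain s where s: "s \<in> {0..?l}" "?\<sigma> s \<in> ?X frontier_of D"
    by blast
  have "mdist (euclid n) (?\<sigma> 0) (?\<sigma> s) = \<bar>0 - s\<bar>"
    using geo s(1) by (simp add: geodesic_def)
  then show False
    using far[OF s(2)] s(1) u(2) ends by simp
qed

lemma euclid_cball_compact:
  assumes z: "z \<in> mspace (euclid n)"
  shows "compactin (mtopology_of (euclid n)) {u \<in> mspace (euclid n). mdist (euclid n) z u \<le> r}"
    (is "compactin _ ?B")
proof -
  have "?B = Metric_space.mcball (mspace (euclid n)) (mdist (euclid n)) z r"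
    using z unfolding Metric_space.mcball_def[OF Metric_space_mspace_mdist] by blast
  then have "closedin (mtopology_of (euclid n)) ?B"
    unfolding mtopology_of_def
    by (simp only: Metric_space.closedin_mcball[OF Metric_space_mspace_mdist])
  then have closed: "closed ?B"
    unfolding mtopology_of_euclid by (rule closedin_Euclidean_imp_closed)
  have coord: "u i \<in> {z i - \<bar>r\<bar>..z i + \<bar>r\<bar>}" if "u \<in> ?B" for u i
  proof (cases "i < n")
    case True
    have "\<bar>z i - u i\<bar> \<le> L2_set (\<lambda>i. \<bar>z i - u i\<bar>) {..<n}"
      by (rule member_le_L2_set) (use True in auto)
    also have "\<dots> = mdist (euclid n) z u"
      by (simp add: L2_set_def mdist_euclid)
    also have "\<dots> \<le> \<bar>r\<bar>"
      using that by auto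
    finally show ?thesis
      unfolding atLeastAtMost_iff by linarith
  next
    case False
    then show ?thesis
      using that z by simp
  qed
  have "compactin (powertop_real UNIV) (PiE UNIV (\<lambda>i. {z i - \<bar>r\<bar>..z i + \<bar>r\<bar>}))"
    unfolding compactin_PiE by simp
  then have "compact (PiE UNIV (\<lambda>i. {z i - \<bar>r\<bar>..z i + \<bar>r\<bar>}))"
    unfolding euclidean_product_topology compactin_euclidean_iff .
  moreover have "?B \<subseteq> PiE UNIV (\<lambda>i. {z i - \<bar>r\<bar>..z i + \<bar>r\<bar>})"
    using coord unfolding PiE_UNIV_domain by blast
  ultimately have "compact ?B"
    using compact_Int_closed[OF _ closed, of "PiE UNIV (\<lambda>i. {z i - \<bar>r\<bar>..z i + \<bar>r\<bar>})"]
    by (simp only: Int_absorb1)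
  then have "compactin (powertop_real UNIV) ?B"
    unfolding euclidean_product_topology compactin_euclidean_iff .
  moreover have "?B \<subseteq> {x. \<forall>i\<ge>n. x i = 0}"
    unfolding mspace_euclid by blast
  ultimately show ?thesis
    unfolding mtopology_of_euclid Euclidean_space_def compactin_subtopology by blast
qed

text \<open>
Openness of the image is Brouwer's invariance of domain.
\<close>

lemma homeomorphic_image_domain:
  assumes D: "domain_in n D" and D': "D' \<subseteq> mspace (euclid n)"
    and f: "homeomorphic_map (subtopology (mtopology_of (euclid n)) D)
              (subtopology (mtopology_of (euclid n)) D') f"
  shows "domain_in n D'"
proof -
  let ?X = "mtopology_of (euclid n)"
  have open_D: "openin ?X D" and "connectedin ?X D" "D \<noteq> {}"
    using D by (auto simp: domain_in_def)
  have D_sub: "D \<subseteq> mspace (euclid n)"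
    using openin_subset[OF open_D] by simp
  have tops: "topspace (subtopology ?X D) = D" "topspace (subtopology ?X D') = D'"
    using D_sub D' by (auto simp del: mspace_euclid)
  have onto: "f ` D = D'" and inj: "inj_on f D"
    using homeomorphic_imp_surjective_map[OF f] homeomorphic_imp_injective_map[OF f]
    by (simp_all only: tops)
  have cont: "continuous_map (subtopology ?X D) ?X f"
    using homeomorphic_imp_continuous_map[OF f] by (simp add: continuous_map_in_subtopology)
  have "connectedin ?X (f ` D)"
    by (rule connectedin_continuous_map_image[OF cont])
       (simp add: connectedin_subtopology \<open>connectedin ?X D\<close>)
  moreover have "openin ?X (f ` D)"
    using invariance_of_domain_Euclidean_space open_D cont inj unfolding mtopology_of_euclid by blast
  ultimately show ?thesis
    using \<open>D \<noteq> {}\<close> onto by (auto simp: domain_in_def)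
qed

section \<open>Quasisymmetric maps and distances to the frontier\<close>

lemma frontier_point_approachable:
  assumes "w \<in> mtopology_of m frontier_of S" "0 < \<epsilon>" "openin (mtopology_of m) U" "w \<in> U"
  obtains u where "u \<in> S" "u \<in> U" "mdist m u w < \<epsilon>"
proof -
  interpret Metric_space "mspace m" "mdist m"
    by (rule Metric_space_mspace_mdist)
  have "w \<in> mtopology closure_of S"
    using assms(1) by (simp add: frontier_of_def mtopology_of_def)
  moreover have "openin mtopology (U \<inter> mball w \<epsilon>)"
    using assms(3) by (simp add: mtopology_of_def openin_Int)
  moreover have "w \<in> U \<inter> mball w \<epsilon>"
    using assms openin_subset[OF assms(3)] by auto
  ultimately show thesis
    using that unfolding in_closure_of by (metis IntD1 IntD2 in_mball commute)
qed

text \<open>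
The quasisymmetry condition compares distances between points of the domain only; this lemma lets the third point be
a frontier point \<open>w\<close> of the image. Points \<open>f u\<close> near \<open>w\<close> have \<open>u\<close> outside the closed ball of radius \<open>r\<close>
around \<open>z\<close>: the ball is a compact subset of \<open>D\<close>, so its image is closed and does not contain \<open>w\<close>. Hence
\<open>|z - p| \<le> t |z - u|\<close>, and quasisymmetry applies to \<open>z\<close>, \<open>p\<close>, \<open>u\<close>. Compactness
enters qualitatively, so that the bound is free of constants depending on the dimension.
\<close>

lemma quasisymmetric_dist_le_frontier:
  assumes D: "D \<subseteq> mspace (euclid n)" and D': "openin (mtopology_of (euclid n)) D'"
    and qs: "quasisymmetric \<eta> (submetric (euclid n) D) (submetric (euclid n) D') f"
    and "z \<in> D" "p \<in> D"
    and far: "\<And>w. w \<in> mtopology_of (euclid n) frontier_of D \<Longrightarrow> r < mdist (euclid n) z w"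
    and t: "0 \<le> t" "0 \<le> \<eta> t" "mdist (euclid n) z p \<le> t * r"
    and w: "w \<in> mtopology_of (euclid n) frontier_of D'"
  shows "mdist (euclid n) (f z) (f p) \<le> \<eta> t * mdist (euclid n) (f z) w"
proof (rule field_le_epsilon)
  fix \<epsilon> :: real assume "0 < \<epsilon>"
  let ?m = "euclid n" let ?X = "mtopology_of ?m"
  let ?B = "{u \<in> mspace ?m. mdist ?m z u \<le> r}"
  have D'_sub: "D' \<subseteq> mspace ?m"
    using openin_subset[OF D'] by simp
  have hom: "homeomorphic_map (subtopology ?X D) (subtopology ?X D') f"
    using qs by (simp add: quasisymmetric_def mtopology_of_submetric)
  have f_onto: "f ` D = D'"
    using homeomorphic_imp_surjective_map[OF hom] D D'_sub by (simp add: inf_absorb2)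
  have B_sub: "?B \<subseteq> D"
    using euclid_cball_subset[OF D \<open>z \<in> D\<close> far] by blast
  have "compactin (subtopology ?X D) ?B"
    using euclid_cball_compact[of z n r] \<open>z \<in> D\<close> D B_sub by (auto simp: compactin_subtopology)
  then have "compactin (subtopology ?X D') (f ` ?B)"
    by (rule image_compactin) (rule homeomorphic_imp_continuous_map[OF hom])
  then have "compactin ?X (f ` ?B)"
    by (simp add: compactin_subtopology)
  moreover have "Hausdorff_space ?X"
    unfolding mtopology_of_def
    by (rule Metric_space.Hausdorff_space_mtopology[OF Metric_space_mspace_mdist])
  ultimately have "closedin ?X (f ` ?B)"
    by (rule compactin_imp_closedin[rotated])
  moreover have w_in: "w \<in> mspace ?m" and "w \<notin> D'"
    using w frontier_of_subset_topspace[of ?X D'] D' by (auto simp: frontier_of_def interior_of_openin)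
  ultimately have "openin ?X (mspace ?m - f ` ?B)" "w \<in> mspace ?m - f ` ?B"
    using B_sub f_onto by (auto simp: closedin_def simp del: mspace_euclid)
  define \<delta> where "\<delta> = \<epsilon> / (\<eta> t + 1)"
  have "0 < \<delta>"
    using \<open>0 < \<epsilon>\<close> t by (simp add: \<delta>_def)
  obtain u' where u': "u' \<in> D'" "u' \<notin> f ` ?B" "mdist ?m u' w < \<delta>"
    using frontier_point_approachable[OF w \<open>0 < \<delta>\<close> \<open>openin ?X (mspace ?m - f ` ?B)\<close>
        \<open>w \<in> mspace ?m - f ` ?B\<close>] by blast
  then obtain u where u: "u \<in> D" "u' = f u" "u \<notin> ?B"
    using f_onto by blast
  then have "r \<le> mdist ?m z u"
    using D by auto
  then have "mdist ?m z p \<le> t * mdist ?m z u"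
    using t mult_left_mono[of r "mdist ?m z u" t] by linarith
  moreover have "z \<in> D \<inter> mspace ?m" "p \<in> D \<inter> mspace ?m" "u \<in> D \<inter> mspace ?m"
    using \<open>z \<in> D\<close> \<open>p \<in> D\<close> u D by blast+
  ultimately have "mdist ?m (f z) (f p) \<le> \<eta> t * mdist ?m (f z) u'"
    using qs t(1) unfolding quasisymmetric_def mspace_submetric mdist_submetric \<open>u' = f u\<close>
    by blast
  also have "\<dots> \<le> \<eta> t * (mdist ?m (f z) w + \<delta>)"
  proof (rule mult_left_mono)
    have "mdist ?m (f z) u' \<le> mdist ?m (f z) w + mdist ?m w u'"
      using w_in f_onto D'_sub u' \<open>z \<in> D\<close> by (intro mdist_triangle) blast+
    then show "mdist ?m (f z) u' \<le> mdist ?m (f z) w + \<delta>"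
      using u' by (simp add: mdist_commute[of ?m w])
  qed (rule t)
  also have "\<dots> \<le> \<eta> t * mdist ?m (f z) w + \<epsilon>"
  proof -
    have "\<eta> t * \<delta> \<le> \<epsilon>"
      using \<open>0 < \<epsilon>\<close> t by (simp add: \<delta>_def field_simps)
    then show ?thesis
      by (simp add: distrib_left)
  qed
  finally show "mdist ?m (f z) (f p) \<le> \<eta> t * mdist ?m (f z) w + \<epsilon>" .
qed

section \<open>Subdividing the arcs of a John domain\<close>

lemma euclid_frontier_nonempty:
  assumes "D \<noteq> {}" "D \<subset> mspace (euclid n)"
  shows "mtopology_of (euclid n) frontier_of D \<noteq> {}"
proof -
  have "connected_space (mtopology_of (euclid n))"
    unfolding mtopology_of_euclid by (rule connected_Euclidean_space)
  then show ?thesis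
    using assms unfolding connected_space_eq_frontier_eq_empty topspace_mtopology_of by blast
qed

text \<open>
The carrot condition bounds the length by a multiple of the distance to the frontier, which is finite because a proper
subset of the connected Euclidean space has a frontier. So the arc is rectifiable and can be parametrized
by length.
\<close>

lemma John_arc_by_length:
  fixes n :: nat and D :: "(nat \<Rightarrow> real) set"
  defines "F \<equiv> mtopology_of (euclid n) frontier_of D"
  assumes John: "length_John_domain n a D x\<^sub>0" and "1 \<le> a" and D: "D \<subset> mspace (euclid n)"
    and x: "x \<in> D" "x \<noteq> x\<^sub>0"
  obtains \<Lambda> \<gamma> where "0 \<le> \<Lambda>" "\<gamma> ` {0..\<Lambda>} \<subseteq> D" "\<gamma> 0 = x" "\<gamma> \<Lambda> = x\<^sub>0"
    "\<And>s t. 0 \<le> s \<Longrightarrow> s \<le> t \<Longrightarrow> t \<le> \<Lambda> \<Longrightarrow> mdist (euclid n) (\<gamma> s) (\<gamma> t) \<le> t - s"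
    "\<And>s. 0 \<le> s \<Longrightarrow> s \<le> \<Lambda> \<Longrightarrow> s \<le> a * dist_to (euclid n) F (\<gamma> s)"
proof -
  let ?m = "euclid n"
  have F: "F \<noteq> {}" "F \<subseteq> mspace ?m"
    using euclid_frontier_nonempty[OF _ D] x frontier_of_subset_topspace[of "mtopology_of ?m" D]
    by (auto simp: F_def simp del: mspace_euclid)
  obtain g where path: "pathin (subtopology (mtopology_of ?m) D) g"
    and ends: "g 0 = x" "g 1 = x\<^sub>0"
    and len: "\<And>t. t \<in> {0..1} \<Longrightarrow> curve_length ?m g 0 t \<le> ennreal a * boundary_dist n D (g t)"
    using John x unfolding length_John_domain_def by blast
  have g_cont: "continuous_map (top_of_set {0..1}) (mtopology_of ?m) g"
    and g_in: "g ` {0..1} \<subseteq> D"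
    using path by (auto simp: pathin_def continuous_map_in_subtopology)
  define L where "L t = enn2real (curve_length ?m g 0 t)" for t
  have bound: "curve_length ?m g 0 t \<le> ennreal (a * mdist ?m (g t) w)"
    if "0 \<le> t" "t \<le> 1" "w \<in> F" for t w
  proof -
    have "boundary_dist n D (g t) \<le> ennreal (mdist ?m (g t) w)"
      unfolding boundary_dist_def using that by (intro INF_lower) (simp add: F_def)
    then have "ennreal a * boundary_dist n D (g t) \<le> ennreal a * ennreal (mdist ?m (g t) w)"
      by (intro mult_left_mono) auto
    also have "\<dots> = ennreal (a * mdist ?m (g t) w)"
      using \<open>1 \<le> a\<close> by (simp add: ennreal_mult)
    finally show ?thesis
      using len[of t] that by (meson atLeastAtMost_iff order_trans)
  qed
  have fin: "curve_length ?m g 0 t = ennreal (L t)" if "0 \<le> t" "t \<le> 1" for t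
  proof -
    obtain w where "w \<in> F"
      using F by blast
    then have "curve_length ?m g 0 t < Orderings.top"
      using bound[OF that] ennreal_less_top le_less_trans by blast
    then show ?thesis
      by (simp add: L_def ennreal_enn2real)
  qed
  have Lnn: "0 \<le> L t" for t
    by (simp add: L_def)
  have L0: "L 0 = 0"
  proof -
    have "curve_length ?m g 0 0 \<le> ennreal (0 * 0)"
    proof (rule curve_length_Lipschitz_le)
      fix r s :: real assume "0 \<le> r" "r \<le> s" "s \<le> 0"
      then have "r = 0" "s = 0"
        by simp_all
      moreover have "g 0 \<in> mspace ?m"
        using ends x D by blast
      then have "mdist ?m (g 0) (g 0) = 0"
        by (simp del: mspace_euclid)
      ultimately show "mdist ?m (g r) (g s) \<le> 0 * (s - r)"
        by simp
    qed auto
    then show ?thesis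
      by (simp add: L_def)
  qed
  have chord: "mdist ?m (g s) (g t) \<le> L t - L s" if "0 \<le> s" "s \<le> t" "t \<le> 1" for s t
  proof -
    have "ennreal (L s + mdist ?m (g s) (g t)) \<le> ennreal (L t)"
      using curve_length_add_chord[OF that(1,2), of ?m g] fin[of s] fin[of t] that Lnn[of s]
      by (simp add: ennreal_plus)
    then show ?thesis
      using Lnn[of t] by simp
  qed
  have carrot: "L t \<le> a * dist_to ?m F (g t)" if "0 \<le> t" "t \<le> 1" for t
  proof -
    have "L t / a \<le> dist_to ?m F (g t)"
    proof (rule dist_to_greatest[OF F(1)])
      fix w assume "w \<in> F"
      then have "L t \<le> a * mdist ?m (g t) w"
        using bound[OF that] fin[OF that] \<open>1 \<le> a\<close> by simp
      then show "L t / a \<le> mdist ?m (g t) w"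
        using \<open>1 \<le> a\<close> by (simp add: field_simps)
    qed
    then show ?thesis
      using \<open>1 \<le> a\<close> by (simp add: field_simps)
  qed
  have cont: "continuous_map (mtopology_of ?m) euclideanreal (\<lambda>z. a * dist_to ?m F z)"
    by (intro continuous_map_real_mult_left continuous_map_dist_to F)
  show thesis
  proof (rule one_Lipschitz_reparametrization[where m = ?m and g = g and L = L
        and h = "\<lambda>z. a * dist_to ?m F z"])
    show "mdist ?m (g s) (g t) \<le> L t - L s" if "0 \<le> s" "s \<le> t" "t \<le> 1" for s t
      using that by (rule chord)
    show "L t \<le> a * dist_to ?m F (g t)" if "0 \<le> t" "t \<le> 1" for t
      using that by (rule carrot)
  next
    fix \<gamma>
    assume \<gamma>: "\<gamma> ` {0..L 1} \<subseteq> g ` {0..1}" "\<gamma> 0 = g 0" "\<gamma> (L 1) = g 1"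
      "\<And>s t. 0 \<le> s \<Longrightarrow> s \<le> t \<Longrightarrow> t \<le> L 1 \<Longrightarrow> mdist ?m (\<gamma> s) (\<gamma> t) \<le> t - s"
      "\<And>s. 0 \<le> s \<Longrightarrow> s \<le> L 1 \<Longrightarrow> s \<le> a * dist_to ?m F (\<gamma> s)"
    show thesis
    proof (rule that)
      show "\<gamma> ` {0..L 1} \<subseteq> D"
        using \<gamma>(1) g_in by (rule order_trans)
      show "\<gamma> 0 = x" "\<gamma> (L 1) = x\<^sub>0"
        using \<gamma>(2,3) ends by simp_all
      show "0 \<le> L 1"
        by (rule Lnn)
    qed (rule \<gamma>(4,5); assumption)+
  qed (rule g_cont L0 cont)+
qed

text \<open>
Grouped into blocks of \<open>K\<close> consecutive indices counted down from \<open>j\<close>, the terms are bounded by a geometric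
series: each block contributes at most \<open>2 * K\<close> times the term at its top, and these top terms are halved from
one block to the next.
\<close>

lemma sum_le_of_geometric_domination:
  fixes E :: "nat \<Rightarrow> real"
  assumes "0 < K"
    and nonneg: "\<And>i. 0 \<le> E i"
    and mono: "\<And>i k. i \<le> k \<Longrightarrow> k \<le> j \<Longrightarrow> E i \<le> 2 * E k"
    and half: "\<And>i k. i + K \<le> k \<Longrightarrow> k \<le> j \<Longrightarrow> E i \<le> E k / 2"
  shows "(\<Sum>i\<le>j. E i) \<le> 4 * real K * E j"
  using mono half
proof (induction j rule: less_induct)
  case (less j)
  show ?case
  proof (cases "K \<le> j")
    case False
    have "(\<Sum>i\<le>j. E i) \<le> (\<Sum>i\<le>j. 2 * E j)"
      by (intro sum_mono less.prems) auto
    also have "\<dots> = 2 * real (Suc j) * E j"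
      by simp
    also have "\<dots> \<le> 4 * real K * E j"
      using False nonneg by (intro mult_right_mono) auto
    finally show ?thesis .
  next
    case True
    have "(\<Sum>i\<le>j - K. E i) \<le> 4 * real K * E (j - K)"
      using \<open>0 < K\<close> True less.prems by (intro less.IH) auto
    also have "\<dots> \<le> 4 * real K * (E j / 2)"
      using True less.prems by (intro mult_left_mono) auto
    finally have 1: "(\<Sum>i\<le>j - K. E i) \<le> 2 * real K * E j"
      by (simp add: mult_ac)
    have "(\<Sum>i\<in>{j - K<..j}. E i) \<le> (\<Sum>i\<in>{j - K<..j}. 2 * E j)"
      by (intro sum_mono less.prems) auto
    also have "\<dots> = 2 * real K * E j"
      using True by simp
    finally have 2: "(\<Sum>i\<in>{j - K<..j}. E i) \<le> 2 * real K * E j" .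
    have "{..j} = {..j - K} \<union> {j - K<..j}"
      by auto
    moreover have "sum E ({..j - K} \<union> {j - K<..j}) = sum E {..j - K} + sum E {j - K<..j}"
      by (intro sum.union_disjoint) auto
    ultimately have "(\<Sum>i\<le>j. E i) = (\<Sum>i\<le>j - K. E i) + (\<Sum>i\<in>{j - K<..j}. E i)"
      by simp
    with 1 2 show ?thesis
      by simp
  qed
qed

text \<open>
The quantity \<open>\<delta> + s\<close> grows by the factor \<open>1 + c\<close> in every step except possibly the last, which is cut off
at \<open>\<Lambda>\<close> and may be arbitrarily short. The strict inequality \<open>i + k < j\<close> in the growth condition leaves room for
this last step.
\<close>

lemma geometric_subdivision:
  fixes \<delta> c \<Lambda> :: real
  assumes "0 < \<delta>" "0 < c" "0 \<le> \<Lambda>"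
  obtains N s where "s 0 = 0" "s N = \<Lambda>" "\<And>i j. i \<le> j \<Longrightarrow> s i \<le> s j"
    "\<And>i. s (Suc i) - s i \<le> c * (\<delta> + s i)"
    "\<And>i j k. i + k < j \<Longrightarrow> j \<le> N \<Longrightarrow> (1 + c) ^ k * (\<delta> + s i) \<le> \<delta> + s j"
proof -
  define G where "G i = \<delta> * ((1 + c) ^ i - 1)" for i
  define s where "s i = min \<Lambda> (G i)" for i
  define N where "N = (LEAST N. \<Lambda> \<le> G N)"
  have G_mono: "G i \<le> G j" if "i \<le> j" for i j
    using that assms by (simp add: G_def power_increasing)
  obtain N' where "1 + \<Lambda> / \<delta> < (1 + c) ^ N'"
    using real_arch_pow[of "1 + c" "1 + \<Lambda> / \<delta>"] assms by auto
  then have "\<Lambda> \<le> G N'"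
    using assms by (simp add: G_def field_simps)
  then have N: "\<Lambda> \<le> G N"
    unfolding N_def by (rule LeastI)
  have before: "G i < \<Lambda>" if "i < N" for i
    using not_less_Least[of i "\<lambda>N. \<Lambda> \<le> G N"] that by (simp add: N_def)
  show thesis
  proof
    show "s 0 = 0" "s N = \<Lambda>"
      using assms N by (simp_all add: s_def G_def)
    show "s i \<le> s j" if "i \<le> j" for i j
      using G_mono[OF that] by (auto simp: s_def)
    show "s (Suc i) - s i \<le> c * (\<delta> + s i)" for i
    proof (cases "G i \<le> \<Lambda>")
      case True
      have "G (Suc i) - G i = c * (\<delta> + G i)"
        by (simp add: G_def algebra_simps)
      then show ?thesis
        using True by (simp add: s_def)
    next
      case False
      moreover have "0 \<le> c * (\<delta> + \<Lambda>)"
        using assms by simp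
      ultimately show ?thesis
        by (simp add: s_def min_def)
    qed
    show "(1 + c) ^ k * (\<delta> + s i) \<le> \<delta> + s j" if "i + k < j" "j \<le> N" for i j k
    proof -
      have "(1 + c) ^ k * (\<delta> + s i) \<le> (1 + c) ^ k * (\<delta> + G i)"
        using assms by (intro mult_left_mono) (auto simp: s_def)
      also have "\<dots> = \<delta> + G (i + k)"
        by (simp add: G_def power_add algebra_simps)
      also have "\<dots> \<le> \<delta> + s j"
        using before[of "i + k"] G_mono[of "i + k" j] that by (simp add: s_def)
      finally show ?thesis .
    qed
  qed
qed

text \<open>
Here \<open>d s\<close> stands for the distance to the frontier at the point \<open>\<gamma> s\<close> of an arc parametrized by length. Near
the start of the arc it is comparable to \<open>d 0\<close> because distance is \<open>1\<close>-Lipschitz, and further on to \<open>s\<close>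
by the carrot condition. So \<open>d 0 + s\<close> measures the scale along the whole arc.
\<close>

lemma carrot_distance_bounds:
  fixes d :: "real \<Rightarrow> real"
  assumes "1 \<le> a" "0 \<le> s"
    and "s \<le> a * d s" "d 0 \<le> s + d s"
  shows "d 0 + s \<le> 3 * a * d s"
proof (cases "2 * s \<le> d 0")
  case True
  then have "0 \<le> d s" "d 0 + s \<le> 3 * d s"
    using assms by linarith+
  moreover have "1 * d s \<le> a * d s"
    using assms \<open>0 \<le> d s\<close> by (intro mult_right_mono) auto
  ultimately show ?thesis
    by linarith
next
  case False
  then show ?thesis
    using assms by linarith
qed

section \<open>Chains in the image\<close>

text \<open>
The points \<open>p i\<close> subdivide the arc so finely, relative to the distance to the frontier, that consecutive image
points \<open>q i\<close> are joined by segments inside \<open>D'\<close>. Let \<open>E j\<close> be the largest distance from \<open>q j\<close> to an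
earlier image point. Three estimates bound the length of the broken line up to \<open>q j\<close>.

\<^item> \<open>E j\<close> is at most \<open>\<eta> (2 * a)\<close> times the distance from \<open>q j\<close> to the frontier, since earlier points
  \<open>p i\<close> satisfy \<open>|p j - p i| \<le> a * d (p j)\<close>.
\<^item> \<open>E i \<le> 2 * E j\<close> for \<open>i \<le> j\<close>, by the triangle inequality.
\<^item> \<open>E i \<le> E j / 2\<close> if \<open>j\<close> comes more than \<open>K\<close> steps after \<open>i\<close>: the scale \<open>\<delta> + s\<close> has then
  grown so much that \<open>p j\<close> is far from \<open>p i\<close>, namely
  \<open>|p i - p k| \<le> \<tau> * |p i - p j|\<close> for every earlier \<open>p k\<close>, and \<open>\<eta> \<tau> \<le> 1 / 2\<close>.

Each edge ending at \<open>q j\<close> is at most \<open>E j\<close>, so the edges up to \<open>q j\<close> have a total length dominated by a geometric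
series. The decay comes from iterating a single factor \<open>1 / 2\<close>; a general \<open>\<eta>\<close> may tend to \<open>0\<close> so
slowly that summing its values over all scales would give a divergent series.
\<close>

lemma quasisymmetric_image_chain:
  fixes n :: nat and D D' :: "(nat \<Rightarrow> real) set"
  defines "F \<equiv> mtopology_of (euclid n) frontier_of D"
    and "F' \<equiv> mtopology_of (euclid n) frontier_of D'"
  assumes John: "length_John_domain n a D x\<^sub>0" and a: "1 \<le> a" and D: "D \<subset> mspace (euclid n)"
    and x: "x \<in> D" "x \<noteq> x\<^sub>0"
    and D': "openin (mtopology_of (euclid n)) D'"
    and qs: "quasisymmetric \<eta> (submetric (euclid n) D) (submetric (euclid n) D') f"
    and \<tau>: "0 < \<tau>" "0 \<le> \<eta> \<tau>" "\<eta> \<tau> \<le> 1 / 2" and \<eta>2a: "0 \<le> \<eta> (2 * a)"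
    and K: "3 * a * (1 + \<tau>) / \<tau> \<le> (1 + \<tau> / (6 * a)) ^ K"
  obtains N q where "q 0 = f x" "q N = f x\<^sub>0" "\<And>i. i \<le> N \<Longrightarrow> q i \<in> D'"
    "\<And>i w. i < N \<Longrightarrow> w \<in> F' \<Longrightarrow>
       mdist (euclid n) (q i) (q (Suc i)) \<le> mdist (euclid n) (q i) w / 2"
    "\<And>j w. j \<le> N \<Longrightarrow> w \<in> F' \<Longrightarrow>
       (\<Sum>i<j. mdist (euclid n) (q i) (q (Suc i)))
         \<le> 4 * real (Suc K) * \<eta> (2 * a) * mdist (euclid n) (q j) w"
proof -
  let ?m = "euclid n"
  have F: "F \<noteq> {}" "F \<subseteq> mspace ?m"
    using euclid_frontier_nonempty[OF _ D] x frontier_of_subset_topspace[of "mtopology_of ?m" D]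
    by (auto simp: F_def simp del: mspace_euclid)
  have D_open: "openin (mtopology_of ?m) D"
    using John by (simp add: length_John_domain_def domain_in_def)
  have D_sub: "D \<subseteq> mspace ?m"
    using D by blast
  have D'_sub: "D' \<subseteq> mspace ?m"
    using openin_subset[OF D'] by simp
  have "f ` (D \<inter> mspace ?m) = D' \<inter> mspace ?m"
    using homeomorphic_imp_surjective_map[of "mtopology_of (submetric ?m D)"
        "mtopology_of (submetric ?m D')" f] qs
    unfolding quasisymmetric_def by (simp del: mspace_euclid)
  then have f_onto: "f ` D = D'"
    using D_sub D'_sub by (simp only: Int_absorb2)
  define d where "d = dist_to ?m F"
  have d_pos: "0 < d z" if "z \<in> D" for z
    unfolding d_def
  proof (rule dist_to_pos[OF D_open that _ F])
    show "D \<inter> F = {}"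
      using D_open by (auto simp: F_def frontier_of_def interior_of_openin)
  qed
  have d_tri: "d y \<le> mdist ?m y z + d z" if "y \<in> D" "z \<in> D" for y z
    unfolding d_def using that D_sub by (intro dist_to_triangle F) blast+
  have far: "d z / 2 < mdist ?m z w" if "z \<in> D" "w \<in> F" for z w
    using d_pos[OF that(1)] dist_to_le[OF that(2), of ?m z] by (simp add: d_def)
  obtain \<Lambda> \<gamma> where \<Lambda>: "0 \<le> \<Lambda>" and \<gamma>_in: "\<gamma> ` {0..\<Lambda>} \<subseteq> D" and ends: "\<gamma> 0 = x" "\<gamma> \<Lambda> = x\<^sub>0"
    and lip: "\<And>s t. 0 \<le> s \<Longrightarrow> s \<le> t \<Longrightarrow> t \<le> \<Lambda> \<Longrightarrow> mdist ?m (\<gamma> s) (\<gamma> t) \<le> t - s"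
    and carrot: "\<And>s. 0 \<le> s \<Longrightarrow> s \<le> \<Lambda> \<Longrightarrow> s \<le> a * d (\<gamma> s)"
    by (rule John_arc_by_length[OF John a D x, folded F_def d_def]) (rule that; assumption)
  define \<delta> where "\<delta> = d x"
  \<comment> \<open>With this \<open>c\<close>, steps of length \<open>c * (\<delta> + s)\<close> are at most \<open>\<tau>\<close> times half the distance to the frontier.\<close>
  define c where "c = \<tau> / (6 * a)"
  have "0 < \<delta>" "0 < c"
    using d_pos[OF x(1)] \<tau> a by (auto simp: \<delta>_def c_def)
  obtain N s where s0: "s 0 = 0" and sN: "s N = \<Lambda>" and s_mono: "\<And>i j. i \<le> j \<Longrightarrow> s i \<le> s j"
    and s_step: "\<And>i. s (Suc i) - s i \<le> c * (\<delta> + s i)"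
    and s_growth: "\<And>i j k. i + k < j \<Longrightarrow> j \<le> N \<Longrightarrow> (1 + c) ^ k * (\<delta> + s i) \<le> \<delta> + s j"
    by (rule geometric_subdivision[OF \<open>0 < \<delta>\<close> \<open>0 < c\<close> \<Lambda>]) (rule that; assumption)
  have s_in: "0 \<le> s i" "s i \<le> \<Lambda>" if "i \<le> N" for i
    using s_mono[of 0 i] s_mono[of i N] s0 sN that by auto
  define p where "p i = \<gamma> (s i)" for i
  define q where "q i = f (p i)" for i
  have p_in: "p i \<in> D" if "i \<le> N" for i
    using \<gamma>_in s_in[OF that] by (auto simp: p_def)
  have q_in: "q i \<in> D'" if "i \<le> N" for i
    using p_in[OF that] f_onto by (auto simp: q_def)
  have p_dist: "mdist ?m (p i) (p j) \<le> s j - s i" if "i \<le> j" "j \<le> N" for i j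
    unfolding p_def using that s_in[of i] s_in[of j] s_mono[of i j] by (intro lip) auto
  have p0: "p 0 = x"
    using ends s0 by (simp add: p_def)
  \<comment> \<open>The scale \<open>\<delta> + s i\<close> is comparable to \<open>d (p i)\<close>, with constants that depend on \<open>a\<close> only.\<close>
  have d_low: "\<delta> + s i \<le> 3 * a * d (p i)" if "i \<le> N" for i
  proof -
    have "d (\<gamma> 0) \<le> s i + d (\<gamma> (s i))"
      using d_tri[of "p 0" "p i"] p_dist[of 0 i] p_in[of 0] p_in[of i] that s0 by (simp add: p_def)
    then show ?thesis
      using carrot_distance_bounds[of a "s i" "\<lambda>t. d (\<gamma> t)"] a s_in[OF that] carrot[of "s i"] ends
      by (simp add: \<delta>_def p_def)
  qed
  have d_up: "d (p i) \<le> \<delta> + s i" if "i \<le> N" for i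
    using d_tri[of "p i" "p 0"] p_dist[of 0 i] p_in[of 0] p_in[of i] that s0 p0
    by (simp add: \<delta>_def mdist_commute[of ?m "p i"])
  have q_frontier: "mdist ?m (q j) (q i) \<le> \<eta> t * mdist ?m (q j) w"
    if "i \<le> N" "j \<le> N" "w \<in> F'" "0 \<le> t" "0 \<le> \<eta> t" "mdist ?m (p j) (p i) \<le> t * (d (p j) / 2)"
    for i j t w
    unfolding q_def
    using that p_in[of i] p_in[of j] far[OF p_in[of j]]
    by (intro quasisymmetric_dist_le_frontier[OF D_sub D' qs, where r = "d (p j) / 2"])
       (auto simp: F_def F'_def)
  have q_qs: "mdist ?m (q i) (q i') \<le> \<eta> \<tau> * mdist ?m (q i) (q j)"
    if "i \<le> N" "i' \<le> N" "j \<le> N" "mdist ?m (p i) (p i') \<le> \<tau> * mdist ?m (p i) (p j)" for i i' j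
  proof -
    have "p i \<in> D \<inter> mspace ?m" "p i' \<in> D \<inter> mspace ?m" "p j \<in> D \<inter> mspace ?m"
      using p_in that D_sub by blast+
    then show ?thesis
      using qs that(4) \<tau>(1) unfolding quasisymmetric_def mspace_submetric mdist_submetric q_def
      by (meson less_imp_le)
  qed
  \<comment> \<open>The value \<open>0\<close> beyond \<open>N\<close> serves to make \<open>E\<close> nonnegative at every index.\<close>
  define E where "E j = (if j \<le> N then Max ((\<lambda>i. mdist ?m (q j) (q i)) ` {..j}) else 0)" for j
  have E_ge: "mdist ?m (q j) (q i) \<le> E j" if "i \<le> j" "j \<le> N" for i j
    using that by (auto simp: E_def intro!: Max_ge)
  have E_le: "E j \<le> b" if "j \<le> N" "\<And>i. i \<le> j \<Longrightarrow> mdist ?m (q j) (q i) \<le> b" for j b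
    using that by (auto simp: E_def)
  have E_nonneg: "0 \<le> E j" for j
  proof (cases "j \<le> N")
    case True
    then show ?thesis
      using E_ge[of 0 j] mdist_nonneg[of ?m "q j" "q 0"] by linarith
  qed (simp add: E_def)
  have E_mono: "E i \<le> 2 * E j" if ij: "i \<le> j" "j \<le> N" for i j
  proof (rule E_le)
    fix k assume "k \<le> i"
    have "mdist ?m (q i) (q k) \<le> mdist ?m (q i) (q j) + mdist ?m (q j) (q k)"
      using q_in[of i] q_in[of j] q_in[of k] ij \<open>k \<le> i\<close> D'_sub by (intro mdist_triangle) auto
    then show "mdist ?m (q i) (q k) \<le> 2 * E j"
      using E_ge[of i j] E_ge[of k j] ij \<open>k \<le> i\<close> by (simp add: mdist_commute[of ?m "q i" "q j"])
  qed (use ij in simp)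
  have E_half: "E i \<le> E j / 2" if ij: "i + Suc K \<le> j" "j \<le> N" for i j
  proof (rule E_le)
    fix k assume "k \<le> i"
    have "3 * a * (1 + \<tau>) / \<tau> * (\<delta> + s i) \<le> (1 + c) ^ K * (\<delta> + s i)"
      using K s_in[of i] ij \<open>0 < \<delta>\<close> by (intro mult_right_mono) (auto simp: c_def)
    also have "\<dots> \<le> \<delta> + s j"
      using ij by (intro s_growth) auto
    also have "\<dots> \<le> 3 * a * d (p j)"
      using ij by (intro d_low) auto
    finally have "3 * a * ((1 + \<tau>) * (\<delta> + s i)) \<le> 3 * a * (\<tau> * d (p j))"
      using \<tau>(1) by (simp add: field_simps)
    then have 1: "(1 + \<tau>) * (\<delta> + s i) \<le> \<tau> * d (p j)"
      using a by (simp only: mult_le_cancel_left_pos)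
    have "d (p j) - (\<delta> + s i) \<le> mdist ?m (p i) (p j)"
      using d_tri[of "p j" "p i"] d_up[of i] p_in[of i] p_in[of j] ij
      by (simp add: mdist_commute[of ?m "p j"])
    then have "\<tau> * (d (p j) - (\<delta> + s i)) \<le> \<tau> * mdist ?m (p i) (p j)"
      using \<tau>(1) by (intro mult_left_mono) auto
    moreover have "mdist ?m (p i) (p k) \<le> \<delta> + s i"
      using p_dist[of k i] s_in[of k] ij \<open>k \<le> i\<close> \<open>0 < \<delta>\<close> by (simp add: mdist_commute[of ?m "p i"])
    ultimately have "mdist ?m (p i) (p k) \<le> \<tau> * mdist ?m (p i) (p j)"
      using 1 by (simp add: algebra_simps)
    then have "mdist ?m (q i) (q k) \<le> \<eta> \<tau> * mdist ?m (q i) (q j)"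
      using ij \<open>k \<le> i\<close> by (intro q_qs) auto
    also have "\<dots> \<le> 1 / 2 * E j"
      using \<tau> E_ge[of i j] ij by (intro mult_mono) (auto simp: mdist_commute[of ?m "q i"])
    finally show "mdist ?m (q i) (q k) \<le> E j / 2"
      by simp
  qed (use ij in simp)
  have E_frontier: "E j \<le> \<eta> (2 * a) * mdist ?m (q j) w" if "j \<le> N" "w \<in> F'" for j w
  proof (rule E_le[OF that(1)])
    fix i assume "i \<le> j"
    have "mdist ?m (p j) (p i) \<le> a * d (p j)"
      using p_dist[of i j] s_in[of i] s_in[of j] carrot[of "s j"] \<open>i \<le> j\<close> that(1)
      by (simp add: p_def mdist_commute[of ?m "\<gamma> (s j)"])
    then show "mdist ?m (q j) (q i) \<le> \<eta> (2 * a) * mdist ?m (q j) w"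
      using \<open>i \<le> j\<close> that a \<eta>2a by (intro q_frontier) auto
  qed
  show thesis
  proof
    show "q 0 = f x" "q N = f x\<^sub>0"
      using p0 ends sN by (simp_all add: q_def p_def)
    show "q i \<in> D'" if "i \<le> N" for i
      using q_in[OF that] .
    show "mdist ?m (q i) (q (Suc i)) \<le> mdist ?m (q i) w / 2" if "i < N" "w \<in> F'" for i w
    proof -
      have "mdist ?m (p i) (p (Suc i)) \<le> c * (\<delta> + s i)"
        using p_dist[of i "Suc i"] s_step[of i] that by simp
      also have "\<dots> \<le> c * (3 * a * d (p i))"
        using d_low[of i] that \<open>0 < c\<close> by (intro mult_left_mono) auto
      also have "\<dots> = \<tau> * (d (p i) / 2)"
        using a by (simp add: c_def field_simps)
      finally have "mdist ?m (q i) (q (Suc i)) \<le> \<eta> \<tau> * mdist ?m (q i) w"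
        using that \<tau> by (intro q_frontier) auto
      also have "\<dots> \<le> 1 / 2 * mdist ?m (q i) w"
        using \<tau> by (intro mult_right_mono) auto
      finally show ?thesis
        by simp
    qed
    show "(\<Sum>i<j. mdist ?m (q i) (q (Suc i))) \<le> 4 * real (Suc K) * \<eta> (2 * a) * mdist ?m (q j) w"
      if j: "j \<le> N" "w \<in> F'" for j w
    proof -
      have "(\<Sum>i<j. mdist ?m (q i) (q (Suc i))) \<le> (\<Sum>i<j. E (Suc i))"
        using j E_ge[of _ "Suc _"] by (intro sum_mono) (auto simp: mdist_commute[of ?m "q _" "q (Suc _)"])
      also have "\<dots> = sum E {1..j}"
        by (rule sum.reindex_bij_witness[of _ "\<lambda>i. i - 1" Suc]) auto
      also have "\<dots> \<le> sum E {..j}"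
        using E_nonneg by (intro sum_mono2) auto
      also have "\<dots> \<le> 4 * real (Suc K) * E j"
        using E_nonneg E_mono E_half j by (intro sum_le_of_geometric_domination) auto
      also have "\<dots> \<le> 4 * real (Suc K) * (\<eta> (2 * a) * mdist ?m (q j) w)"
        using E_frontier[OF j] by (intro mult_left_mono) auto
      finally show ?thesis
        by (simp add: mult.assoc)
    qed
  qed
qed

text \<open>
The arc runs along the segments of the broken line through the \<open>q i\<close>, with loops erased. A point \<open>z\<close> on the
segment from \<open>q i\<close> has distance at most \<open>|q i - w| / 2\<close> from \<open>q i\<close>, hence \<open>|q i - w| \<le> 2 * |z - w|\<close> for every
frontier point \<open>w\<close>, so that the bound at \<open>q i\<close> extends to \<open>z\<close> at the cost of a factor \<open>2\<close> and a term for
the part of the last segment.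
\<close>

lemma John_arc_along_chain:
  fixes n :: nat and D :: "(nat \<Rightarrow> real) set"
  defines "F \<equiv> mtopology_of (euclid n) frontier_of D"
  assumes D: "openin (mtopology_of (euclid n)) D" and "0 \<le> C"
    and q: "\<And>i. i \<le> N \<Longrightarrow> q i \<in> D" and "q 0 \<noteq> q N"
    and step: "\<And>i w. i < N \<Longrightarrow> w \<in> F \<Longrightarrow>
       mdist (euclid n) (q i) (q (Suc i)) \<le> mdist (euclid n) (q i) w / 2"
    and sum: "\<And>j w. j \<le> N \<Longrightarrow> w \<in> F \<Longrightarrow>
       (\<Sum>i<j. mdist (euclid n) (q i) (q (Suc i))) \<le> C * mdist (euclid n) (q j) w"
  shows "\<exists>g. pathin (subtopology (mtopology_of (euclid n)) D) g \<and> inj_on g {0..1} \<and>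
           g 0 = q 0 \<and> g 1 = q N \<and>
           (\<forall>t \<in> {0..1}. curve_length (euclid n) g 0 t
              \<le> ennreal (2 * C + 1) * boundary_dist n D (g t))"
proof -
  let ?m = "euclid n"
  define l where "l i = mdist ?m (q i) (q (Suc i))" for i
  define \<sigma> where "\<sigma> i = segment_param n (q i) (q (Suc i))" for i
  have D_sub: "D \<subseteq> mspace ?m"
    using openin_subset[OF D] by simp
  have q_in: "q i \<in> mspace ?m" if "i \<le> N" for i
    using q[OF that] D_sub by blast
  have \<sigma>: "geodesic ?m (\<sigma> i) (l i) \<and> \<sigma> i 0 = q i \<and> \<sigma> i (l i) = q (Suc i)" if "i < N" for i
    using geodesic_segment_param[of "q i" n "q (Suc i)"] segment_param_ends[of "q i" n "q (Suc i)"]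
      q_in[of i] q_in[of "Suc i"] that
    unfolding \<sigma>_def l_def by simp
  obtain T \<beta> where T: "0 \<le> T" and \<beta>_in: "\<beta> ` {0..T} \<subseteq> mspace ?m" and inj: "inj_on \<beta> {0..T}"
    and ends: "\<beta> 0 = q 0" "\<beta> T = q N"
    and lip: "\<And>s t. 0 \<le> s \<Longrightarrow> s \<le> t \<Longrightarrow> t \<le> T \<Longrightarrow> mdist ?m (\<beta> s) (\<beta> t) \<le> t - s"
    and on: "\<And>t. 0 < t \<Longrightarrow> t \<le> T \<Longrightarrow> \<exists>i<N. \<beta> t \<in> \<sigma> i ` {0..l i} \<and> t \<le> (\<Sum>k\<le>i. l k)"
    using injective_curve_along_chain[of q ?m N \<sigma> l, OF q_in[OF le0] \<sigma>] by blast
  have "0 < T"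
    using T ends \<open>q 0 \<noteq> q N\<close> by (cases "T = 0") auto
  have frontier_in: "w \<in> mspace ?m" "w \<notin> D" if "w \<in> F" for w
    using that frontier_of_subset_topspace[of "mtopology_of ?m" D] D
    by (auto simp: F_def frontier_of_def interior_of_openin simp del: mspace_euclid)
  have on_segment: "\<beta> t \<in> D \<and> (\<forall>w\<in>F. t \<le> (2 * C + 1) * mdist ?m (\<beta> t) w)"
    if t: "0 < t" "t \<le> T" for t
  proof -
    obtain i u where i: "i < N" and u: "0 \<le> u" "u \<le> l i" "\<beta> t = \<sigma> i u" and ti: "t \<le> (\<Sum>k\<le>i. l k)"
      using on[OF t] by auto
    have \<beta>t: "\<beta> t \<in> mspace ?m"
      using \<beta>_in t by (auto simp del: mspace_euclid)
    have "0 \<in> {0..l i}" "u \<in> {0..l i}"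
      using u by auto
    then have "mdist ?m (\<sigma> i 0) (\<sigma> i u) = \<bar>0 - u\<bar>"
      using \<sigma>[OF i] unfolding geodesic_def by blast
    then have qz: "mdist ?m (q i) (\<beta> t) = u"
      using \<sigma>[OF i] u by simp
    have half: "2 * l i \<le> mdist ?m (q i) w" if "w \<in> F" for w
      using step[OF i that] by (simp add: l_def)
    have pos: "0 < mdist ?m (q i) w" if "w \<in> F" for w
    proof -
      have "mdist ?m (q i) w \<noteq> 0"
        using mdist_zero[OF q_in frontier_in(1)[OF that], of i] i q[of i] frontier_in(2)[OF that] by auto
      then show ?thesis
        using mdist_nonneg[of ?m "q i" w] by linarith
    qed
    have "\<beta> t \<in> D"
    proof (rule euclid_cball_subset[OF D_sub q[of i], of "l i"])
      show "l i < mdist ?m (q i) w" if "w \<in> mtopology_of ?m frontier_of D" for w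
        using half[of w] pos[of w] that u unfolding F_def by linarith
    qed (use i qz u \<beta>t in auto)
    moreover have "t \<le> (2 * C + 1) * mdist ?m (\<beta> t) w" if w: "w \<in> F" for w
    proof -
      have "mdist ?m (q i) w \<le> mdist ?m (q i) (\<beta> t) + mdist ?m (\<beta> t) w"
        using q_in[of i] i \<beta>t frontier_in[OF w] by (intro mdist_triangle) auto
      then have near: "mdist ?m (q i) w \<le> 2 * mdist ?m (\<beta> t) w"
        using half[OF w] qz u by linarith
      have "t \<le> (\<Sum>k<i. l k) + l i"
        using ti by (simp flip: lessThan_Suc_atMost)
      also have "\<dots> \<le> C * mdist ?m (q i) w + mdist ?m (q i) w / 2"
        using sum[of i w] i w half[OF w] by (intro add_mono) (auto simp: l_def)
      also have "\<dots> \<le> C * (2 * mdist ?m (\<beta> t) w) + mdist ?m (\<beta> t) w"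
        using near \<open>0 \<le> C\<close> by (intro add_mono mult_left_mono) auto
      finally show ?thesis
        by (simp add: algebra_simps)
    qed
    ultimately show ?thesis
      by blast
  qed
  \<comment> \<open>The parameter interval has to be \<open>{0..1}\<close>; the rescaled curve is \<open>T\<close>-Lipschitz.\<close>
  define g where "g r = \<beta> (T * r)" for r
  have scale: "0 \<le> T * r" "T * r \<le> T" if "0 \<le> r" "r \<le> 1" for r
    using that T by (auto simp: mult_left_le)
  have g_in: "g r \<in> D" if "0 \<le> r" "r \<le> 1" for r
  proof (cases "r = 0")
    case True
    then show ?thesis
      using ends q[of 0] by (simp add: g_def)
  next
    case False
    then show ?thesis
      using on_segment[of "T * r"] scale[OF that] that \<open>0 < T\<close> by (simp add: g_def)
  qed
  have g_lip: "mdist ?m (g r) (g r') \<le> T * (r' - r)" if "0 \<le> r" "r \<le> r'" "r' \<le> 1" for r r'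
    using lip[of "T * r" "T * r'"] scale[of r] scale[of r'] that T
    by (simp add: g_def right_diff_distrib mult_left_mono)
  have "curve_length ?m g 0 r \<le> ennreal (2 * C + 1) * boundary_dist n D (g r)"
    if r: "0 \<le> r" "r \<le> 1" for r
  proof -
    have "curve_length ?m g 0 r \<le> ennreal (T * r)"
      using T r g_lip by (intro curve_length_Lipschitz_le) auto
    also have "ennreal (T * r) = ennreal (2 * C + 1) * ennreal (T * r / (2 * C + 1))"
      using \<open>0 \<le> C\<close> scale[OF r] by (subst ennreal_mult[symmetric]) auto
    also have "\<dots> \<le> ennreal (2 * C + 1) * boundary_dist n D (g r)"
      unfolding boundary_dist_def F_def[symmetric]
    proof (intro mult_left_mono INF_greatest ennreal_leI)
      fix w assume "w \<in> F"
      have "T * r \<le> (2 * C + 1) * mdist ?m (g r) w"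
      proof (cases "r = 0")
        case True
        then show ?thesis
          using \<open>0 \<le> C\<close> by simp
      next
        case False
        then have "0 < T * r"
          using r \<open>0 < T\<close> by simp
        then show ?thesis
          using on_segment[of "T * r"] scale[OF r] \<open>w \<in> F\<close> unfolding g_def by blast
      qed
      then show "T * r / (2 * C + 1) \<le> mdist ?m (g r) w"
        using \<open>0 \<le> C\<close> by (simp add: pos_divide_le_eq mult.commute)
    qed simp
    finally show ?thesis .
  qed
  moreover have "pathin (subtopology (mtopology_of ?m) D) g"
  proof -
    have "continuous_map (top_of_set {0..1}) (mtopology_of ?m) g"
    proof (rule continuous_map_of_Lipschitz)
      show "g ` {0..1} \<subseteq> mspace ?m"
        using g_in D_sub by (auto simp del: mspace_euclid)
    qed (rule g_lip)
    then show ?thesis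
      using g_in by (auto simp: pathin_def continuous_map_in_subtopology)
  qed
  moreover have "inj_on g {0..1}"
  proof (rule inj_onI)
    fix r r' assume r: "r \<in> {0..1}" "r' \<in> {0..1}" "g r = g r'"
    then have "T * r = T * r'"
      using inj_onD[OF inj, of "T * r" "T * r'"] scale[of r] scale[of r'] by (simp add: g_def)
    then show "r = r'"
      using \<open>0 < T\<close> by simp
  qed
  moreover have "g 0 = q 0" "g 1 = q N"
    using ends by (simp_all add: g_def)
  ultimately show ?thesis
    by (intro exI[of _ g]) auto
qed

section \<open>Quasisymmetric invariance of length John domains\<close>

theorem corollary3p2:
  fixes a :: real and \<eta> :: "real \<Rightarrow> real"
  assumes "a \<ge> 1"
    and "homeomorphic_map (top_of_set {0..}) (top_of_set {0..}) \<eta>"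
  shows "\<exists>a'\<ge>1. \<forall>(n::nat) D D' x\<^sub>0 f.
           D \<subset> mspace (euclid n) \<longrightarrow>
           length_John_domain n a D x\<^sub>0 \<longrightarrow>
           D' \<subseteq> mspace (euclid n) \<longrightarrow>
           quasisymmetric \<eta> (submetric (euclid n) D) (submetric (euclid n) D') f \<longrightarrow>
           length_John_domain n a' D' (f x\<^sub>0)"
proof -
  have \<eta>_onto: "\<eta> ` {0..} = {0..}"
    using homeomorphic_imp_surjective_map[OF assms(2)] by simp
  then have \<eta>_nonneg: "0 \<le> \<eta> t" if "0 \<le> t" for t
    using that by auto
  \<comment> \<open>Two distinct arguments with values at most \<open>1 / 2\<close>: the larger one is positive, as the estimates require.\<close>
  obtain t1 t2 where t: "0 \<le> t1" "\<eta> t1 = 1 / 2" "0 \<le> t2" "\<eta> t2 = 1 / 4"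
  proof -
    have "1 / 2 \<in> \<eta> ` {0..}" "1 / 4 \<in> \<eta> ` {0..}"
      unfolding \<eta>_onto by auto
    then show thesis
      using that by (metis (no_types, lifting) atLeast_iff imageE)
  qed
  define \<tau> where "\<tau> = max t1 t2"
  have "t1 \<noteq> t2"
    using t by auto
  then have \<tau>: "0 < \<tau>" "0 \<le> \<eta> \<tau>" "\<eta> \<tau> \<le> 1 / 2"
    using t by (auto simp: \<tau>_def max_def)
  obtain K where "3 * a * (1 + \<tau>) / \<tau> < (1 + \<tau> / (6 * a)) ^ K"
    using real_arch_pow[of "1 + \<tau> / (6 * a)" "3 * a * (1 + \<tau>) / \<tau>"] \<tau> assms(1) by auto
  then have K: "3 * a * (1 + \<tau>) / \<tau> \<le> (1 + \<tau> / (6 * a)) ^ K"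
    by simp
  define C where "C = 4 * real (Suc K) * \<eta> (2 * a)"
  have \<eta>2a: "0 \<le> \<eta> (2 * a)"
    using assms(1) by (intro \<eta>_nonneg) simp
  then have "0 \<le> C"
    by (simp add: C_def)
  show ?thesis
  proof (intro exI[of _ "2 * C + 1"] conjI allI impI)
    show "1 \<le> 2 * C + 1"
      using \<open>0 \<le> C\<close> by simp
    fix n :: nat and D D' x\<^sub>0 and f :: "(nat \<Rightarrow> real) \<Rightarrow> nat \<Rightarrow> real"
    assume D: "D \<subset> mspace (euclid n)" and John: "length_John_domain n a D x\<^sub>0"
      and D': "D' \<subseteq> mspace (euclid n)"
      and qs: "quasisymmetric \<eta> (submetric (euclid n) D) (submetric (euclid n) D') f"
    have hom: "homeomorphic_map (subtopology (mtopology_of (euclid n)) D)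
        (subtopology (mtopology_of (euclid n)) D') f"
      using qs by (simp add: quasisymmetric_def mtopology_of_submetric)
    have dom: "domain_in n D'"
      using John by (intro homeomorphic_image_domain[OF _ D' hom]) (simp add: length_John_domain_def)
    then have open': "openin (mtopology_of (euclid n)) D'"
      by (simp add: domain_in_def)
    have onto: "f ` D = D'"
      using homeomorphic_imp_surjective_map[OF hom] D D'
      by (simp add: Int_absorb1 psubset_imp_subset del: mspace_euclid)
    have "x\<^sub>0 \<in> D"
      using John by (simp add: length_John_domain_def)
    show "length_John_domain n (2 * C + 1) D' (f x\<^sub>0)"
      unfolding length_John_domain_def
    proof (intro conjI dom ballI)
      show "f x\<^sub>0 \<in> D'"
        using onto \<open>x\<^sub>0 \<in> D\<close> by blast
      fix y assume y: "y \<in> D' - {f x\<^sub>0}"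
      then obtain x where x: "x \<in> D" "x \<noteq> x\<^sub>0" "y = f x"
        using onto by blast
      show "\<exists>g. pathin (subtopology (mtopology_of (euclid n)) D') g \<and> inj_on g {0..1} \<and>
          g 0 = y \<and> g 1 = f x\<^sub>0 \<and>
          (\<forall>t\<in>{0..1}. curve_length (euclid n) g 0 t
             \<le> ennreal (2 * C + 1) * boundary_dist n D' (g t))"
      proof (rule quasisymmetric_image_chain[OF John assms(1) D x(1,2) open' qs \<tau> \<eta>2a K])
        fix N q
        assume q: "q 0 = f x" "q N = f x\<^sub>0" "\<And>i. i \<le> N \<Longrightarrow> q i \<in> D'"
          "\<And>i w. i < N \<Longrightarrow> w \<in> mtopology_of (euclid n) frontier_of D' \<Longrightarrow>
             mdist (euclid n) (q i) (q (Suc i)) \<le> mdist (euclid n) (q i) w / 2"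
          "\<And>j w. j \<le> N \<Longrightarrow> w \<in> mtopology_of (euclid n) frontier_of D' \<Longrightarrow>
             (\<Sum>i<j. mdist (euclid n) (q i) (q (Suc i)))
               \<le> 4 * real (Suc K) * \<eta> (2 * a) * mdist (euclid n) (q j) w"
        have "q 0 \<noteq> q N"
          using q(1,2) x(3) y by auto
        from John_arc_along_chain[OF open' \<open>0 \<le> C\<close> q(3) this q(4) q(5)[folded C_def]]
        show ?thesis
          unfolding q(1,2) x(3) .
      qed
    qed
  qed
qed

end
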